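(* Consider the Linear Feasibility problem in the coordinator model: each of $s$ servers holds a matrix $A^{(i)}$ (with $d$ columns) and a vector $b^{(i)}$, all entries held to $L$ bits of precision; with $A$ and $b$ the vertical stacks of the $A^{(i)}$ and $b^{(i)}$, the coordinator must decide whether there is $x\in\mathbb{R}^d$ with $Ax\le b$. Any protocol solving Linear Feasibility in the coordinator model requires at least $\Omega(sdL)$ communication, for protocols that exchange at most $cL/\log L$ rounds of messages with each server (for an absolute constant $c$) and when $\log d\le5L$. This bound holds even when the number of constraints is promised to be at most $O(s+d)$. For constant $d$, the $\Omega(sL)$ lower bound holds with no assumption on the number of rounds.
   Context: Coordinator model: $s$ servers each communicate only with a coordinator, and every bit sent to or received by the coordinator counts toward the communication.
   Formalization: The bounds are stated for s ≥ 2, d ≥ 2 and L ≥ 2: with one server a single bit suffices, for d = 1 randomized protocols compare interval endpoints with O(log L) bits, so the bounds fail there, and for L = 1 the quantity L/log L is undefined. *)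

theory Defs
  imports
    "HOL-Probability.Probability_Mass_Function"
    "Jordan_Normal_Form.Matrix"
begin

section \<open>Linear Feasibility with distributed constraints\<close>

text \<open>The input of one server is a pair \<open>(A, b)\<close>; an instance lists the inputs of the servers.\<close>

type_synonym server_input = "real mat \<times> real vec"
type_synonym lf_input = "server_input list"

fun stack_mat :: "nat \<Rightarrow> lf_input \<Rightarrow> real mat" where
  "stack_mat d [] = 0\<^sub>m 0 d"
| "stack_mat d ((A, b) # X) = A @\<^sub>r stack_mat d X"

fun stack_vec :: "lf_input \<Rightarrow> real vec" where
  "stack_vec [] = 0\<^sub>v 0"
| "stack_vec ((A, b) # X) = b @\<^sub>v stack_vec X"

definition feasible :: "nat \<Rightarrow> lf_input \<Rightarrow> bool" where
  "feasible d X \<longleftrightarrow> (\<exists>x \<in> carrier_vec d. stack_mat d X *\<^sub>v x \<le> stack_vec X)"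

text \<open>
  The \<open>L\<close>-bit numbers are the \<open>2 ^ L\<close> signed integers in two's complement. Fixed-point numbers with
  a common scaling factor give the same problem, since multiplying all of \<open>A\<close> and \<open>b\<close> by
  a positive constant does not affect feasibility.
\<close>

definition L_bit :: "nat \<Rightarrow> real set" where
  "L_bit L = real_of_int ` {- (2 ^ (L - 1)) ..< 2 ^ (L - 1)}"

definition LF_instances :: "nat \<Rightarrow> nat \<Rightarrow> nat \<Rightarrow> lf_input set" where
  "LF_instances s d L = {X. length X = s \<and>
     (\<forall>(A, b) \<in> set X. A \<in> carrier_mat (dim_vec b) d \<and>
        elements_mat A \<subseteq> L_bit L \<and> set\<^sub>v b \<subseteq> L_bit L)}"

definition LF_promise :: "nat \<Rightarrow> nat \<Rightarrow> nat \<Rightarrow> nat \<Rightarrow> lf_input set" where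
  "LF_promise n s d L = {X \<in> LF_instances s d L. dim_row (stack_mat d X) \<le> n}"

lemma stack_carrier:
  assumes "\<And>A b. (A, b) \<in> set X \<Longrightarrow> A \<in> carrier_mat (dim_vec b) d"
  shows "stack_mat d X \<in> carrier_mat (dim_vec (stack_vec X)) d"
  using assms
proof (induction X)
  case (Cons p X)
  obtain A b where p: "p = (A, b)" by (cases p)
  have "A \<in> carrier_mat (dim_vec b) d" using Cons.prems p by auto
  moreover have "stack_mat d X \<in> carrier_mat (dim_vec (stack_vec X)) d"
    using Cons by auto
  ultimately show ?case using p by auto
qed auto

lemma feasible_iff:
  assumes "X \<in> LF_instances s d L"
  shows "feasible d X \<longleftrightarrow> (\<exists>x \<in> carrier_vec d. \<forall>(A, b) \<in> set X. A *\<^sub>v x \<le> b)"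
proof -
  have car: "A \<in> carrier_mat (dim_vec b) d" if "(A, b) \<in> set X" for A b
    using assms that by (auto simp: LF_instances_def)
  have "stack_mat d X *\<^sub>v x \<le> stack_vec X \<longleftrightarrow> (\<forall>(A, b) \<in> set X. A *\<^sub>v x \<le> b)"
    if x: "x \<in> carrier_vec d" for x
    using car
  proof (induction X)
    case Nil
    then show ?case using x by (auto simp: less_eq_vec_def)
  next
    case (Cons p X)
    obtain A b where p: "p = (A, b)" by (cases p)
    have A: "A \<in> carrier_mat (dim_vec b) d" using Cons.prems p by auto
    have S: "stack_mat d X \<in> carrier_mat (dim_vec (stack_vec X)) d"
      using Cons.prems by (intro stack_carrier) auto
    have "(A @\<^sub>r stack_mat d X) *\<^sub>v x \<le> b @\<^sub>v stack_vec X \<longleftrightarrow>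
        A *\<^sub>v x \<le> b \<and> stack_mat d X *\<^sub>v x \<le> stack_vec X"
      using A S x by (intro append_rows_le) auto
    then show ?case using Cons p by auto
  qed
  then show ?thesis unfolding feasible_def by blast
qed

section \<open>The coordinator model\<close>

text \<open>
  A transcript lists the bits exchanged so far, each tagged with the server on whose link it travels;
  it is exactly what the coordinator, who has no input, knows. Server \<open>i\<close> knows its input and the
  bits on its own link. Who sends the next bit on link \<open>i\<close> is determined by the earlier bits
  on that link (\<open>server_turn\<close>), so no information is conveyed by silence or timing;
  \<open>next_link\<close> only fixes the order in which the links are served and when the coordinator stops.
\<close>

type_synonym transcript = "(nat \<times> bool) list"

record protocol =
  next_link :: "transcript \<Rightarrow> nat option"
  coord_bit :: "transcript \<Rightarrow> bool"
  answer :: "transcript \<Rightarrow> bool"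
  server_turn :: "nat \<Rightarrow> bool list \<Rightarrow> bool"
  server_bit :: "nat \<Rightarrow> server_input \<Rightarrow> bool list \<Rightarrow> bool"

definition link_view :: "nat \<Rightarrow> transcript \<Rightarrow> bool list" where
  "link_view i T = map snd (filter (\<lambda>e. fst e = i) T)"

definition next_bit :: "protocol \<Rightarrow> lf_input \<Rightarrow> nat \<Rightarrow> transcript \<Rightarrow> bool" where
  "next_bit P X i T =
     (if server_turn P i (link_view i T) then server_bit P i (X ! i) (link_view i T)
      else coord_bit P T)"

inductive execution :: "protocol \<Rightarrow> lf_input \<Rightarrow> transcript \<Rightarrow> bool" for P X where
  start: "execution P X []"
| step: "execution P X T \<Longrightarrow> next_link P T = Some i \<Longrightarrow> i < length X \<Longrightarrow>
    execution P X (T @ [(i, next_bit P X i T)])"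

text \<open>
  The coordinator may stop only when every server has completed its message: it cannot skip
  (and so not pay for) bits that a server is about to send.
\<close>

definition complete_execution :: "protocol \<Rightarrow> lf_input \<Rightarrow> transcript \<Rightarrow> bool" where
  "complete_execution P X T \<longleftrightarrow>
     execution P X T \<and> next_link P T = None \<and>
     (\<forall>i < length X. \<not> server_turn P i (link_view i T))"

lemma execution_prefix:
  assumes "execution P X T" and "execution P X T'"
  shows "(\<exists>U. T' = T @ U) \<or> (\<exists>U. T = T' @ U)"
  using assms
proof (induction arbitrary: T' rule: execution.induct)
  case (step T i)
  consider U where "T' = T @ U" "U \<noteq> []" | U where "T = T' @ U"
    using step.IH[OF step.prems] by (metis append_Nil2)
  then show ?case
  proof cases
    case 1
    have "\<exists>V. T' = T @ (i, next_bit P X i T) # V"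
      using step.prems 1 step.hyps(2)
    proof (induction arbitrary: U rule: execution.induct)
      case (step T2 j)
      show ?case
      proof (cases "T2 = T")
        case True
        then show ?thesis using step by auto
      next
        case False
        obtain W w where "U = W @ [w]" using step.prems by (cases U rule: rev_cases) auto
        then have "T2 = T @ W" "W \<noteq> []" using step.prems False by auto
        then show ?thesis using step.IH step.prems(3) by fastforce
      qed
    qed auto
    then show ?thesis by auto
  qed auto
qed auto

lemma complete_execution_unique:
  assumes "complete_execution P X T" and "complete_execution P X T'"
  shows "T = T'"
proof -
  have stuck: "U = []" if "execution P X S" "S = R @ U" "next_link P R = None" for S R U
    using that
  proof (induction arbitrary: U rule: execution.induct)
    case (step T i)
    show ?case
    proof (cases U rule: rev_cases)
      case (snoc W w)
      then have "T = R @ W" using step.prems by auto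
      then show ?thesis using step.IH step.prems(2) step.hyps(2) by fastforce
    qed
  qed auto
  show ?thesis
    using execution_prefix[of P X T T'] stuck assms
    unfolding complete_execution_def by (metis append_Nil2)
qed

text \<open>Number of messages on link \<open>i\<close>: maximal blocks of consecutive bits from the same sender.\<close>

definition num_messages :: "protocol \<Rightarrow> nat \<Rightarrow> transcript \<Rightarrow> nat" where
  "num_messages P i T =
     (let v = link_view i T
      in length (remdups_adj (map (\<lambda>k. server_turn P i (take k v)) [0 ..< length v])))"

text \<open>
  A randomized protocol is a distribution over deterministic ones, i.e. all parties share the
  random coins (private coins are a special case). Round and communication complexity are worst
  case over the instances in \<open>I\<close> and over the coins; the error probability is at most \<open>1/3\<close>.
\<close>

definition solves_LF :: "nat \<Rightarrow> lf_input set \<Rightarrow> protocol pmf \<Rightarrow> bool" where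
  "solves_LF d I R \<longleftrightarrow>
     (\<forall>X \<in> I. (\<forall>P \<in> set_pmf R. \<exists>T. complete_execution P X T) \<and>
       measure_pmf.prob R {P. \<exists>T. complete_execution P X T \<and> (answer P T \<longleftrightarrow> feasible d X)}
         \<ge> 2 / 3)"

definition rounds_at_most :: "real \<Rightarrow> lf_input set \<Rightarrow> protocol pmf \<Rightarrow> bool" where
  "rounds_at_most r I R \<longleftrightarrow>
     (\<forall>X \<in> I. \<forall>P \<in> set_pmf R. \<forall>T. complete_execution P X T \<longrightarrow>
        (\<forall>i < length X. real (num_messages P i T) \<le> r))"

definition comm_at_least :: "real \<Rightarrow> lf_input set \<Rightarrow> protocol pmf \<Rightarrow> bool" where
  "comm_at_least B I R \<longleftrightarrow>
     (\<exists>X \<in> I. \<exists>P \<in> set_pmf R. \<exists>T. complete_execution P X T \<and> B \<le> real (length T))"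

end

theory Submission
  imports Defs
begin

text \<open>
  One server fixes a point \<open>y\<close> by equality constraints, every other server holds a single halfspace
  \<open>\<langle>x, y\<rangle> \<ge> z\<close>. Let \<open>x\<close>, \<open>y\<close> be uniform in \<open>{0..<N}\<^sup>n\<close> and \<open>z = \<langle>x, y\<rangle> \<mp> T - t\<close>, where \<open>t\<close> follows a
  Fejer kernel concentrated on \<open>\<bar>t\<bar> < T\<close>. The two signs give satisfied and violated constraints, but
  no partition into few rectangles tells them apart. The difference of the two densities splits
  into three parts: one that the trivial bound \<open>1\<close> on an acceptance probability controls, one of
  frequencies so low that the shift by \<open>T\<close> hardly changes it, and one of middle frequencies, on
  which the bilinear phases \<open>e(k\<langle>x, y\<rangle> / M)\<close> have a tiny operator norm. This gives a two-party lower bound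
  of order \<open>n log N\<close>.

  All halfspaces share the point \<open>y\<close>, so given \<open>y\<close> the servers are independent: for each server, everybody
  else can be simulated by the party that knows \<open>y\<close>, and only the bits on its own link are charged.
  Hence the bounds add up over the links. For bounded \<open>L\<close> it suffices that every server must be
  contacted with probability at least \<open>1/3\<close>, which also excludes less than one round.
\<close>

section \<open>Additive characters modulo M\<close>

text \<open>The noise has to be a probability density with few frequencies, hence a Fejer kernel F.
  Its coefficients are not flat at frequency 0, so the difference of a wide and a narrow one keeps
  low frequencies, and there the phases hardly oscillate. De la Vallee Poussin kernels V are flat
  but can be negative. The identity 8 F_8a = 7 V + F_a joins the two: F is sampled, V is analysed,
  and F_a costs 1/8 of acceptance probability. This is affordable because error 1/3 still leaves a
  gap of 1/3 between satisfied and violated constraints. All scales are powers of \<open>r\<close>: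
  noise width about r^12, shift r^13, low-frequency kernels of width about r^14, so that tails and
  shift errors are O(1/r). Middle frequencies save a factor of about r^5 per coordinate in a second
  moment. Their number, about n r^8, is paid once and is at most 2^n r^(4n) because
  \<open>n \<ge> 2\<close>. A factor of about r per coordinate survives, which is worth order n log
  r bits, and \<open>r\<close> will be exponential in \<open>L\<close>.\<close>

definition chi :: "nat \<Rightarrow> int \<Rightarrow> complex" where
  "chi M j = cis (2 * pi * real_of_int j / real M)"

lemma chi_0 [simp]: "chi M 0 = 1"
  by (simp add: chi_def)

lemma chi_add: "chi M (i + j) = chi M i * chi M j"
  by (simp add: chi_def cis_mult add_divide_distrib distrib_left)

lemma chi_minus: "chi M (- j) = cnj (chi M j)"
  by (simp add: chi_def cis_cnj)

lemma norm_chi [simp]: "cmod (chi M j) = 1"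
  by (simp add: chi_def)

lemma chi_power: "chi M j ^ k = chi M (j * int k)"
  by (simp add: chi_def Complex.DeMoivre mult_ac)

lemma chi_sum: "chi M (sum f A) = (\<Prod>a\<in>A. chi M (f a))"
  by (induction A rule: infinite_finite_induct) (auto simp: chi_add)

lemma chi_period: "M > 0 \<Longrightarrow> chi M (j * int M) = 1"
  using cis_multiple_2pi[of "of_int j"] by (simp add: chi_def mult.assoc)

lemma norm_cis_diff_1: "cmod (cis t - 1) = 2 * \<bar>sin (t / 2)\<bar>"
proof -
  have "cis t - 1 = cis (t/2) * (cis (t/2) - cis (-(t/2)))"
    by (simp add: cis_mult right_diff_distrib)
  also have "cis (t/2) - cis (-(t/2)) = 2 * \<i> * of_real (sin (t/2))"
    by (simp add: complex_eq_iff)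
  finally show ?thesis by (simp add: norm_mult)
qed

lemma norm_chi_diff_1: "cmod (chi M j - 1) = 2 * \<bar>sin (pi * real_of_int j / real M)\<bar>"
  unfolding chi_def norm_cis_diff_1 by simp

lemma chi_eq_1_iff:
  assumes "M > 0"
  shows "chi M j = 1 \<longleftrightarrow> int M dvd j"
proof
  assume "chi M j = 1"
  then have "sin (pi * real_of_int j / real M) = 0"
    using norm_chi_diff_1[of M j] by simp
  then obtain i :: int where "pi * real_of_int j / real M = of_int i * pi"
    unfolding sin_zero_iff_int2 by auto
  then have "real_of_int j = real_of_int (i * int M)"
    using assms by (simp add: field_simps)
  then have "j = i * int M" by (simp only: of_int_eq_iff)
  then show "int M dvd j" by simp
next
  assume "int M dvd j"
  then show "chi M j = 1" using chi_period[OF assms] by (metis dvdE mult.commute)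
qed

lemma sum_int_interval: "(\<Sum>z\<in>{c..<c + int m}. f z) = (\<Sum>k<m. f (c + int k))"
  by (rule sum.reindex_bij_witness[of _ "\<lambda>k. c + int k" "\<lambda>z. nat (z - c)"]) auto

text \<open>Kept in multiplied form, so that it covers both the vanishing of full sums and the size
  of partial ones.\<close>

lemma sum_chi_geometric:
  "(chi M j - 1) * (\<Sum>z\<in>{c..<c + int m}. chi M (j * z)) = chi M (j * c) * (chi M (j * int m) - 1)"
proof -
  have "(\<Sum>z\<in>{c..<c + int m}. chi M (j * z)) = chi M (j * c) * (\<Sum>k<m. chi M j ^ k)"
    unfolding sum_int_interval by (simp add: ring_distribs chi_add sum_distrib_left chi_power)
  moreover have "(chi M j - 1) * (\<Sum>k<m. chi M j ^ k) = chi M j ^ m - 1"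
    by (rule power_diff_1_eq[symmetric])
  ultimately show ?thesis by (simp add: chi_power mult.left_commute)
qed

lemma sum_chi_full:
  assumes "M > 0"
  shows "(\<Sum>z\<in>{c..<c + int M}. chi M (j * z)) = (if int M dvd j then of_nat M else 0)"
proof (cases "int M dvd j")
  case True
  then have "chi M (j * z) = 1" for z using chi_eq_1_iff[OF assms] by auto
  then show ?thesis using True by simp
next
  case False
  then have "chi M j - 1 \<noteq> 0" using chi_eq_1_iff[OF assms] by auto
  moreover have "chi M (j * int M) = 1" using chi_period[OF assms] .
  ultimately show ?thesis using sum_chi_geometric[of M j c M] False by simp
qed

text \<open>Expanding the square leaves one full character sum over \<open>z\<close> for each pair
  of frequencies, and distinctness modulo \<open>M\<close> kills the off-diagonal pairs. The offsets
  \<open>c\<close> and \<open>h\<close> admit any window of \<open>M\<close> consecutive thresholds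
  and any centre.\<close>

lemma parseval:
  assumes M: "M > 0" and S: "finite S"
    and inj: "\<And>k k'. k \<in> S \<Longrightarrow> k' \<in> S \<Longrightarrow> int M dvd k - k' \<Longrightarrow> k = k'"
  shows "(\<Sum>z\<in>{c..<c + int M}. (cmod (\<Sum>k\<in>S. f k * chi M (k * (h - z))))\<^sup>2)
    = real M * (\<Sum>k\<in>S. (cmod (f k))\<^sup>2)"
proof -
  have sq: "of_real ((cmod w)\<^sup>2) = w * cnj w" for w :: complex
    by (simp only: complex_norm_square)
  have "complex_of_real (\<Sum>z\<in>{c..<c + int M}. (cmod (\<Sum>k\<in>S. f k * chi M (k * (h - z))))\<^sup>2)
     = (\<Sum>z\<in>{c..<c + int M}. \<Sum>k\<in>S. \<Sum>k'\<in>S. f k * cnj (f k') * chi M ((k - k') * h) * chi M ((k' - k) * z))"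
  proof -
    have "chi M (k * (h - z)) * cnj (chi M (k' * (h - z))) = chi M ((k - k') * h) * chi M ((k' - k) * z)"
      for k k' z
      by (simp flip: chi_minus chi_add add: algebra_simps)
    then have "f k * chi M (k * (h - z)) * cnj (f k' * chi M (k' * (h - z))) =
        f k * cnj (f k') * chi M ((k - k') * h) * chi M ((k' - k) * z)" for k k' z
      by (simp add: mult_ac)
    then show ?thesis
      unfolding of_real_sum sq cnj_sum sum_product by (simp only:)
  qed
  also have "\<dots> = (\<Sum>k\<in>S. \<Sum>k'\<in>S. f k * cnj (f k') * chi M ((k - k') * h) * (\<Sum>z\<in>{c..<c + int M}. chi M ((k' - k) * z)))"
    unfolding sum_distrib_left by (subst sum.swap, rule sum.cong[OF refl], subst sum.swap, rule refl)
  also have "\<dots> = (\<Sum>k\<in>S. \<Sum>k'\<in>S. if k' = k then f k * cnj (f k) * of_nat M else 0)"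
    unfolding sum_chi_full[OF M] using inj by (intro sum.cong refl) auto
  also have "\<dots> = of_real (real M * (\<Sum>k\<in>S. (cmod (f k))\<^sup>2))"
    using S by (simp add: sum_distrib_left mult_ac flip: sq del: of_real_power)
  finally show ?thesis by (simp only: of_real_eq_iff)
qed

text \<open>The range goes past \<open>1/2\<close> because the differences \<open>ip x y - z\<close>
  reach \<open>3/4 * M\<close>, and \<open>5/6 * M\<close> leaves room for the shift by
  \<open>T\<close> without reducing to symmetric residues. The factor \<open>1/5\<close> is what
  \<open>1 - u \<ge> u / 5\<close> allows at \<open>u = 5/6\<close>.\<close>

lemma sin_pi_ge:
  assumes "0 \<le> u" "u \<le> 5/6"
  shows "sin (pi * u) \<ge> u / 5"
proof -
  have half: "sin (pi * v) \<ge> v" if "0 \<le> v" "v \<le> 1/2" for v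
  proof (cases "v \<le> 1/3")
    case True
    have "(\<lambda>x. sin x - x / 2) 0 \<le> (\<lambda>x. sin x - x / 2) (pi * v)"
    proof (rule DERIV_nonneg_imp_nondecreasing[where f = "\<lambda>x. sin x - x / 2"])
      show "0 \<le> pi * v" using that by simp
      fix x assume x: "0 \<le> x" "x \<le> pi * v"
      have "pi * v \<le> pi * (1/3)" using True by (intro mult_left_mono) auto
      then have "x \<le> pi / 3" using x by linarith
      then have "cos (pi / 3) \<le> cos x"
        using x by (intro cos_monotone_0_pi_le) auto
      then have "0 \<le> cos x - 1/2" by (simp add: cos_60)
      moreover have "((\<lambda>x. sin x - x / 2) has_real_derivative cos x - 1/2) (at x)"
        by (auto intro!: derivative_eq_intros)
      ultimately show "\<exists>y. ((\<lambda>x. sin x - x / 2) has_real_derivative y) (at x) \<and> 0 \<le> y"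
        by blast
    qed
    moreover have "2 * v \<le> pi * v" using pi_ge_two that by (intro mult_right_mono) auto
    ultimately show ?thesis by simp
  next
    case False
    have "pi * v \<le> pi * (1/2)" "pi * (1/3) \<le> pi * v"
      using False that by (intro mult_left_mono; simp)+
    then have "sin (pi / 3) \<le> sin (pi * v)"
      using pi_gt_zero by (intro sin_monotone_2pi_le) linarith+
    moreover have "sqrt 3 \<ge> sqrt ((3/2)\<^sup>2)" by (intro real_sqrt_le_mono) (simp add: power2_eq_square)
    ultimately show ?thesis using that by (simp add: sin_60)
  qed
  show ?thesis
  proof (cases "u \<le> 1/2")
    case True
    then show ?thesis using half[of u] assms by auto
  next
    case False
    have "sin (pi * u) = sin (pi * (1 - u))" by (simp add: right_diff_distrib sin_diff)
    also have "\<dots> \<ge> 1 - u" using half[of "1-u"] False assms by auto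
    finally show ?thesis using assms by simp
  qed
qed

text \<open>A geometric sum is at most \<open>2 / cmod (chi M j - 1)\<close> whatever its length,
  and the sine bound turns this into decay in \<open>j\<close>.\<close>

lemma norm_sum_chi_le:
  assumes M: "M > 0" and j: "j \<noteq> 0" "\<bar>real_of_int j\<bar> \<le> 5/6 * real M"
  shows "cmod (\<Sum>z\<in>{c..<c + int m}. chi M (j * z)) \<le> 5 * real M / \<bar>real_of_int j\<bar>"
proof -
  let ?S = "\<Sum>z\<in>{c..<c + int m}. chi M (j * z)"
  define u where "u = \<bar>real_of_int j\<bar> / real M"
  have u: "0 < u" "u \<le> 5/6" using j M by (auto simp: u_def field_simps)
  have "\<bar>sin (pi * real_of_int j / real M)\<bar> = \<bar>sin (pi * u)\<bar>"
    by (cases "j \<ge> 0") (auto simp: u_def)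
  then have "2 * u / 5 \<le> cmod (chi M j - 1)"
    unfolding norm_chi_diff_1 using sin_pi_ge[of u] u by auto
  then have "2 * u / 5 * cmod ?S \<le> cmod (chi M j - 1) * cmod ?S"
    by (intro mult_right_mono) auto
  also have "\<dots> = cmod (chi M (j * int m) - 1)"
    unfolding norm_mult[symmetric] sum_chi_geometric by (simp add: norm_mult)
  also have "\<dots> \<le> 2"
    using norm_triangle_ineq4[of "chi M (j * int m)" 1] by simp
  finally have "cmod ?S \<le> 5 / u" using u by (simp add: field_simps)
  then show ?thesis by (simp add: u_def)
qed

lemma norm_chi_shift_diff_le:
  "cmod (chi M (k * t) - chi M (- (k * t))) \<le> 4 * pi * \<bar>real_of_int k\<bar> * \<bar>real_of_int t\<bar> / real M"
proof -
  have "chi M (k * t) - chi M (- (k * t)) = chi M (- (k * t)) * (chi M (2 * k * t) - 1)"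
    by (simp add: right_diff_distrib flip: chi_add)
  then have "cmod (chi M (k * t) - chi M (- (k * t))) = 2 * \<bar>sin (pi * real_of_int (2 * k * t) / real M)\<bar>"
    by (simp add: norm_mult norm_chi_diff_1)
  also have "\<dots> \<le> 2 * \<bar>pi * real_of_int (2 * k * t) / real M\<bar>"
    by (intro mult_left_mono abs_sin_x_le_abs_x) auto
  finally show ?thesis by (simp add: abs_mult mult_ac)
qed

section \<open>Fejer kernels on a cyclic group\<close>

definition dirichlet :: "nat \<Rightarrow> nat \<Rightarrow> int \<Rightarrow> complex" where
  "dirichlet M m t = (\<Sum>k\<in>{0..<int m}. chi M (k * t))"

text \<open>Normalised to total mass \<open>1\<close> over a period; being a square, it can serve as
  a probability density.\<close>

definition fejer :: "nat \<Rightarrow> nat \<Rightarrow> int \<Rightarrow> real" where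
  "fejer M m t = (cmod (dirichlet M m t))\<^sup>2 / (real m * real M)"

lemma fejer_nonneg [simp]: "0 \<le> fejer M m t"
  by (simp add: fejer_def)

lemma dvd_diff_small:
  assumes "int M dvd k - k'" "\<bar>k - k'\<bar> < int M"
  shows "k = k'"
  using assms by (metis abs_ge_zero dvd_abs_iff eq_iff_diff_eq_0 zdvd_not_zless linorder_not_less order_le_less abs_eq_0)

lemma sum_dirichlet_sq:
  assumes "0 < m" "m \<le> M"
  shows "(\<Sum>z\<in>{c..<c + int M}. (cmod (dirichlet M m (h - z)))\<^sup>2) = real M * real m"
  using parseval[of M "{0..<int m}" "\<lambda>_. 1" h c] assms
  by (force simp: dirichlet_def intro: dvd_diff_small)

lemma sum_fejer:
  assumes "0 < m" "m \<le> M"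
  shows "(\<Sum>z\<in>{c..<c + int M}. fejer M m (h - z)) = 1"
  using sum_dirichlet_sq[OF assms, of h c] assms
  by (simp add: fejer_def flip: sum_divide_distrib)

lemma fejer_le:
  assumes "0 < m" "0 < M" "t \<noteq> 0" "\<bar>real_of_int t\<bar> \<le> 5/6 * real M"
  shows "fejer M m t \<le> 25 * real M / (real m * (real_of_int t)\<^sup>2)"
proof -
  have "cmod (dirichlet M m t) \<le> 5 * real M / \<bar>real_of_int t\<bar>"
    using norm_sum_chi_le[of M t 0 m] assms by (simp add: dirichlet_def mult.commute)
  then have "(cmod (dirichlet M m t))\<^sup>2 \<le> (5 * real M / \<bar>real_of_int t\<bar>)\<^sup>2"
    by (intro power_mono) auto
  then have "fejer M m t \<le> (5 * real M / \<bar>real_of_int t\<bar>)\<^sup>2 / (real m * real M)"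
    unfolding fejer_def by (intro divide_right_mono) auto
  also have "\<dots> = 25 * real M / (real m * (real_of_int t)\<^sup>2)"
    using assms by (simp add: power_divide power_mult_distrib power2_eq_square)
  finally show ?thesis .
qed

text \<open>A difference of squares is at most \<open>e * (f + g)\<close>. After Cauchy-Schwarz,
  Parseval evaluates \<open>f\<close> and \<open>g\<close>, and it bounds \<open>e\<close> because a
  shift by \<open>T\<close> changes the coefficient at frequency \<open>k < m\<close> only by O(k T
  / M). The outcome is the shift relative to the scale \<open>M / m\<close> of the kernel.\<close>

lemma fejer_shift_diff:
  assumes m: "0 < m" "m \<le> M"
  shows "(\<Sum>z\<in>{c..<c + int M}. \<bar>fejer M m (h - z - T) - fejer M m (h - z + T)\<bar>)
    \<le> 8 * pi * real m * \<bar>real_of_int T\<bar> / real M"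
proof -
  let ?Z = "{c..<c + int M}"
  define f g where "f z = cmod (dirichlet M m ((h - T) - z))" and "g z = cmod (dirichlet M m ((h + T) - z))" for z
  define e where "e z = cmod (dirichlet M m ((h - T) - z) - dirichlet M m ((h + T) - z))" for z
  have f: "(\<Sum>z\<in>?Z. (f z)\<^sup>2) = real M * real m" and g: "(\<Sum>z\<in>?Z. (g z)\<^sup>2) = real M * real m"
    unfolding f_def g_def by (rule sum_dirichlet_sq[OF m])+
  have e: "(\<Sum>z\<in>?Z. (e z)\<^sup>2) \<le> real M * real m * (4 * pi * real m * \<bar>real_of_int T\<bar> / real M)\<^sup>2"
  proof -
    have "dirichlet M m ((h - T) - z) - dirichlet M m ((h + T) - z) =
        (\<Sum>k\<in>{0..<int m}. (chi M (- (k * T)) - chi M (k * T)) * chi M (k * (h - z)))" for z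
      unfolding dirichlet_def sum_subtractf[symmetric] left_diff_distrib chi_add[symmetric]
      by (intro sum.cong refl) (simp add: algebra_simps)
    then have "(\<Sum>z\<in>?Z. (e z)\<^sup>2) = real M * (\<Sum>k\<in>{0..<int m}. (cmod (chi M (- (k * T)) - chi M (k * T)))\<^sup>2)"
      unfolding e_def using parseval[of M "{0..<int m}" "\<lambda>k. chi M (- (k * T)) - chi M (k * T)" h c] m
      by (force intro: dvd_diff_small)
    also have "\<dots> \<le> real M * (\<Sum>k\<in>{0..<int m}. (4 * pi * real m * \<bar>real_of_int T\<bar> / real M)\<^sup>2)"
    proof (intro mult_left_mono sum_mono power_mono)
      fix k assume k: "k \<in> {0..<int m}"
      have "cmod (chi M (- (k * T)) - chi M (k * T)) \<le> 4 * pi * \<bar>real_of_int k\<bar> * \<bar>real_of_int T\<bar> / real M"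
        using norm_chi_shift_diff_le[of M k T] by (simp add: norm_minus_commute)
      also have "\<dots> \<le> 4 * pi * real m * \<bar>real_of_int T\<bar> / real M"
        using k by (intro divide_right_mono mult_right_mono mult_left_mono) auto
      finally show "cmod (chi M (- (k * T)) - chi M (k * T)) \<le> 4 * pi * real m * \<bar>real_of_int T\<bar> / real M" .
    qed auto
    finally show ?thesis by (simp add: mult_ac)
  qed
  have le: "\<bar>(f z)\<^sup>2 - (g z)\<^sup>2\<bar> \<le> e z * (f z + g z)" for z
  proof -
    have "(f z)\<^sup>2 - (g z)\<^sup>2 = (f z - g z) * (f z + g z)" by (simp add: power2_eq_square algebra_simps)
    moreover have "\<bar>f z - g z\<bar> \<le> e z" unfolding f_def g_def e_def by (rule norm_triangle_ineq3)
    moreover have "0 \<le> f z + g z" by (simp add: f_def g_def)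
    ultimately show ?thesis by (simp add: abs_mult mult_right_mono)
  qed
  have "(\<Sum>z\<in>?Z. \<bar>(f z)\<^sup>2 - (g z)\<^sup>2\<bar>) \<le> (\<Sum>z\<in>?Z. e z * (f z + g z))"
    by (intro sum_mono le)
  also have "\<dots> \<le> sqrt (\<Sum>z\<in>?Z. (e z)\<^sup>2) * sqrt (\<Sum>z\<in>?Z. (f z + g z)\<^sup>2)"
    using L2_set_mult_ineq[of e "\<lambda>z. f z + g z" ?Z]
    by (simp add: L2_set_def e_def f_def g_def)
  also have "\<dots> \<le> sqrt (real M * real m * (4 * pi * real m * \<bar>real_of_int T\<bar> / real M)\<^sup>2) * sqrt (4 * (real M * real m))"
  proof (intro mult_mono real_sqrt_le_mono e)
    have "(f z + g z)\<^sup>2 \<le> 2 * (f z)\<^sup>2 + 2 * (g z)\<^sup>2" for z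
      using zero_le_power2[of "f z - g z"] by (simp add: power2_eq_square algebra_simps)
    then have "(\<Sum>z\<in>?Z. (f z + g z)\<^sup>2) \<le> (\<Sum>z\<in>?Z. 2 * (f z)\<^sup>2 + 2 * (g z)\<^sup>2)"
      by (intro sum_mono)
    also have "\<dots> = 4 * (real M * real m)"
      unfolding sum.distrib sum_distrib_left[symmetric] f g by simp
    finally show "(\<Sum>z\<in>?Z. (f z + g z)\<^sup>2) \<le> 4 * (real M * real m)" .
  qed (auto intro!: real_sqrt_ge_zero sum_nonneg)
  also have "\<dots> = (real m * real M) * (8 * pi * real m * \<bar>real_of_int T\<bar> / real M)"
  proof -
    have "sqrt (x * y\<^sup>2) * sqrt (4 * x) = x * (2 * y)" if "0 \<le> x" "0 \<le> y" for x y :: real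
      using that by (simp add: real_sqrt_mult)
    from this[of "real M * real m" "4 * pi * real m * \<bar>real_of_int T\<bar> / real M"]
    show ?thesis by simp
  qed
  finally have "(\<Sum>z\<in>?Z. \<bar>(f z)\<^sup>2 - (g z)\<^sup>2\<bar>) / (real m * real M) \<le> 8 * pi * real m * \<bar>real_of_int T\<bar> / real M"
    using m by (simp add: divide_le_eq mult.commute)
  moreover have "\<bar>fejer M m (h - z - T) - fejer M m (h - z + T)\<bar> = \<bar>(f z)\<^sup>2 - (g z)\<^sup>2\<bar> / (real m * real M)" for z
    by (simp add: fejer_def f_def g_def algebra_simps flip: diff_divide_distrib)
  ultimately show ?thesis by (simp add: sum_divide_distrib)
qed

text \<open>The triangular Fejer coefficients, unnormalised: the number of pairs in
  \<open>{0..<m}\<close> with difference \<open>k\<close>.\<close>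

definition fejer_coeff :: "nat \<Rightarrow> int \<Rightarrow> real" where
  "fejer_coeff m k = max 0 (real m - \<bar>real_of_int k\<bar>)"

text \<open>Adding the frequency \<open>m\<close> to the Dirichlet sum adds to its square every
  character with \<open>\<bar>k\<bar> \<le> m\<close> exactly once, just as the triangle grows by
  \<open>1\<close> on that range.\<close>

lemma dirichlet_sq_fourier:
  "complex_of_real ((cmod (dirichlet M m t))\<^sup>2) = (\<Sum>k\<in>{- int m..int m}. of_real (fejer_coeff m k) * chi M (k * t))"
proof (induction m)
  case 0
  then show ?case by (simp add: dirichlet_def fejer_coeff_def)
next
  case (Suc m)
  let ?I = "{- int m..int m}"
  have d: "dirichlet M (Suc m) t = dirichlet M m t + chi M (int m * t)"
  proof -
    have "{0..<int (Suc m)} = insert (int m) {0..<int m}" by auto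
    then show ?thesis by (simp add: dirichlet_def)
  qed
  have c1: "dirichlet M m t * cnj (chi M (int m * t)) = (\<Sum>k\<in>{- int m..<0}. chi M (k * t))"
    unfolding dirichlet_def sum_distrib_right chi_minus[symmetric] chi_add[symmetric]
    by (rule sum.reindex_bij_witness[of _ "\<lambda>k. k + int m" "\<lambda>k. k - int m"]) (auto simp: algebra_simps)
  have c2: "cnj (dirichlet M m t) * chi M (int m * t) = (\<Sum>k\<in>{0<..int m}. chi M (k * t))"
    unfolding dirichlet_def cnj_sum sum_distrib_right chi_minus[symmetric] chi_add[symmetric]
    by (rule sum.reindex_bij_witness[of _ "\<lambda>k. int m - k" "\<lambda>k. int m - k"]) (auto simp: algebra_simps)
  have "complex_of_real ((cmod (dirichlet M (Suc m) t))\<^sup>2) = dirichlet M (Suc m) t * cnj (dirichlet M (Suc m) t)"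
    by (rule complex_norm_square)
  also have "\<dots> = dirichlet M m t * cnj (dirichlet M m t) + dirichlet M m t * cnj (chi M (int m * t))
      + cnj (dirichlet M m t) * chi M (int m * t) + chi M (int m * t) * cnj (chi M (int m * t))"
    unfolding d by (simp add: algebra_simps)
  also have "chi M (int m * t) * cnj (chi M (int m * t)) = 1"
    by (simp flip: chi_minus chi_add)
  also have "dirichlet M m t * cnj (dirichlet M m t) = of_real ((cmod (dirichlet M m t))\<^sup>2)"
    by (rule complex_norm_square[symmetric])
  also have "of_real ((cmod (dirichlet M m t))\<^sup>2) + dirichlet M m t * cnj (chi M (int m * t))
      + cnj (dirichlet M m t) * chi M (int m * t) + 1 = (\<Sum>k\<in>?I. of_real (fejer_coeff m k) * chi M (k * t)) + (\<Sum>k\<in>?I. chi M (k * t))"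
  proof -
    have "?I = {- int m..<0} \<union> insert 0 {0<..int m}" by auto
    then have "(\<Sum>k\<in>?I. chi M (k * t)) = (\<Sum>k\<in>{- int m..<0}. chi M (k * t)) + (1 + (\<Sum>k\<in>{0<..int m}. chi M (k * t)))"
      by (simp only:) (subst sum.union_disjoint, auto)
    then show ?thesis unfolding Suc.IH c1 c2 by simp
  qed
  also have "\<dots> = (\<Sum>k\<in>?I. of_real (fejer_coeff (Suc m) k) * chi M (k * t))"
    unfolding sum.distrib[symmetric] by (intro sum.cong refl) (auto simp: fejer_coeff_def max_def algebra_simps)
  also have "\<dots> = (\<Sum>k\<in>{- int (Suc m)..int (Suc m)}. of_real (fejer_coeff (Suc m) k) * chi M (k * t))"
    by (rule sum.mono_neutral_left) (auto simp: fejer_coeff_def)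
  finally show ?case .
qed

text \<open>The range \<open>b\<close> may exceed the width \<open>m\<close>, so that kernels of
  different widths can be combined coefficient by coefficient.\<close>

lemma fejer_fourier:
  assumes "m \<le> b" "0 < M"
  shows "complex_of_real (real m * real M * fejer M m t) =
    (\<Sum>k\<in>{- int b..int b}. of_real (fejer_coeff m k) * chi M (k * t))"
proof -
  have "complex_of_real (real m * real M * fejer M m t) = of_real ((cmod (dirichlet M m t))\<^sup>2)"
    using assms by (cases "m = 0") (auto simp: fejer_def dirichlet_def)
  also have "\<dots> = (\<Sum>k\<in>{- int b..int b}. of_real (fejer_coeff m k) * chi M (k * t))"
    unfolding dirichlet_sq_fourier using assms by (intro sum.mono_neutral_left) (auto simp: fejer_coeff_def)
  finally show ?thesis .
qed

section \<open>Elementary sums: harmonic series, sums over differences, inverse squares\<close>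

lemma harmonic_le_ln:
  assumes "N \<ge> 1"
  shows "(\<Sum>d=1..N. 1 / real d) \<le> 1 + ln (real N)"
  using assms
proof (induction N rule: dec_induct)
  case (step k)
  have "ln (real k / real (Suc k)) \<le> real k / real (Suc k) - 1"
    using step.hyps by (intro ln_le_minus_one) auto
  then have "1 / real (Suc k) \<le> ln (real (Suc k)) - ln (real k)"
    using step.hyps by (simp add: ln_div field_simps)
  then show ?case using step.IH step.hyps by simp
qed simp

lemma sum_dist_le:
  fixes g :: "int \<Rightarrow> real"
  assumes g: "\<And>d. 0 \<le> g d" and y: "y \<in> {0..<int N}"
  shows "(\<Sum>w\<in>{0..<int N}. g (y - w)) \<le> g 0 + (\<Sum>d=1..N. g (int d) + g (- int d))"
proof -
  have "(\<Sum>w\<in>{0..<y}. g (y - w)) = (\<Sum>d\<in>{1..nat y}. g (int d))"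
    using y by (intro sum.reindex_bij_witness[of _ "\<lambda>d. y - int d" "\<lambda>w. nat (y - w)"]) auto
  also have "\<dots> \<le> (\<Sum>d=1..N. g (int d))"
    using y g by (intro sum_mono2) auto
  finally have 1: "(\<Sum>w\<in>{0..<y}. g (y - w)) \<le> (\<Sum>d=1..N. g (int d))" .
  have "(\<Sum>w\<in>{y<..<int N}. g (y - w)) = (\<Sum>d\<in>{1..N - 1 - nat y}. g (- int d))"
    using y by (intro sum.reindex_bij_witness[of _ "\<lambda>d. y + int d" "\<lambda>w. nat (w - y)"]) auto
  also have "\<dots> \<le> (\<Sum>d=1..N. g (- int d))"
    using y g by (intro sum_mono2) auto
  finally have 2: "(\<Sum>w\<in>{y<..<int N}. g (y - w)) \<le> (\<Sum>d=1..N. g (- int d))" .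
  have "{0..<int N} = {0..<y} \<union> insert y {y<..<int N}" using y by auto
  then have "(\<Sum>w\<in>{0..<int N}. g (y - w)) = (\<Sum>w\<in>{0..<y}. g (y - w)) + (g 0 + (\<Sum>w\<in>{y<..<int N}. g (y - w)))"
    by (simp only:) (subst sum.union_disjoint, auto)
  then show ?thesis using 1 2 by (simp add: sum.distrib)
qed

lemma sum_inverse_squares_le:
  assumes "2 \<le> T" "finite S" "\<And>t. t \<in> S \<Longrightarrow> T \<le> t"
  shows "(\<Sum>t\<in>S. 1 / (real_of_int t)\<^sup>2) \<le> 2 / real_of_int T"
proof -
  have tele: "(\<Sum>k<m. 1 / (real_of_int (T + int k))\<^sup>2) \<le> 1 / (real_of_int T - 1) - 1 / (real_of_int T + real m - 1)" for m
  proof (induction m)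
    case (Suc m)
    define u where "u = real_of_int T + real m"
    have u: "u \<ge> 2" using assms(1) by (simp add: u_def)
    have "1 / u\<^sup>2 \<le> 1 / (u - 1) - 1 / u"
      using u by (simp add: field_simps power2_eq_square)
    then show ?case using Suc by (simp add: u_def)
  qed simp
  define m where "m = nat (Max (insert T S) - T + 1)"
  have sub: "S \<subseteq> {T..<T + int m}"
  proof
    fix t assume t: "t \<in> S"
    then have "t \<le> Max (insert T S)" using assms(2) by auto
    then show "t \<in> {T..<T + int m}" using assms(3)[OF t] by (auto simp: m_def)
  qed
  have "(\<Sum>t\<in>S. 1 / (real_of_int t)\<^sup>2) \<le> (\<Sum>t\<in>{T..<T + int m}. 1 / (real_of_int t)\<^sup>2)"
    using sub by (intro sum_mono2) auto
  also have "\<dots> \<le> 1 / (real_of_int T - 1) - 1 / (real_of_int T + real m - 1)"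
    unfolding sum_int_interval by (rule tele)
  also have "\<dots> \<le> 1 / (real_of_int T - 1)"
    using assms(1) by simp
  also have "\<dots> \<le> 2 / real_of_int T"
    using assms(1) by (simp add: field_simps)
  finally show ?thesis .
qed

section \<open>The two-party halfspace problem\<close>

locale lf_params =
  fixes r n :: nat
  assumes r_ge: "r \<ge> 1000" and n_ge: "n \<ge> 2"
begin

text \<open>
  The kernels of frequency widths \<open>mb > ma > lb > la\<close> live on the scales \<open>M / mb = r ^ 12 / 2\<close> up to
  \<open>M / la = 4 * r ^ 14\<close>. The shift \<open>T\<close> lies between those of \<open>ma\<close> and \<open>lb\<close>, and all of them lie
  between \<open>N\<close> and \<open>N ^ 2\<close>. \<open>M\<close> is large enough that no wrap-around modulo \<open>M\<close> occurs.
\<close>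

definition N :: nat where "N = r ^ 10"
definition M :: nat where "M = 4 * n * r ^ 20"
definition T :: int where "T = int (r ^ 13)"
definition mb :: nat where "mb = 8 * n * r ^ 8"
definition ma :: nat where "ma = n * r ^ 8"
definition lb :: nat where "lb = 8 * n * r ^ 6"
definition la :: nat where "la = n * r ^ 6"
definition vecs :: "(nat \<Rightarrow> int) set" where "vecs = PiE {..<n} (\<lambda>_. {0..<int N})"
definition zs :: "int set" where "zs = {- int (2 * n * r ^ 20)..<- int (2 * n * r ^ 20) + int M}"
definition ip :: "(nat \<Rightarrow> int) \<Rightarrow> (nat \<Rightarrow> int) \<Rightarrow> int" where "ip x y = (\<Sum>j<n. x j * y j)"

lemma params_pos: "0 < r" "0 < N" "0 < M" "0 < mb" "0 < ma" "0 < lb" "0 < la" "0 < T"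
  using r_ge n_ge by (auto simp: N_def M_def mb_def ma_def lb_def la_def T_def)

lemma pow_le: "i \<le> j \<Longrightarrow> r ^ i \<le> r ^ j"
  using params_pos(1) by (intro power_increasing) auto

text \<open>The last inequality makes the frequencies from \<open>- mb\<close> to \<open>mb\<close>
  distinct modulo \<open>M\<close>, as Parseval requires.\<close>

lemma widths_le: "ma \<le> mb" "lb \<le> ma" "la \<le> lb" "2 * mb < M" 
proof -
  show "ma \<le> mb" "la \<le> lb" by (auto simp: mb_def ma_def lb_def la_def)
  have "8 * r ^ 6 \<le> r ^ 2 * r ^ 6"
    using r_ge mult_mono[of 8 r 1 r] by (intro mult_right_mono) (auto simp: power2_eq_square)
  then show "lb \<le> ma" by (simp add: lb_def ma_def flip: power_add)
  have "8 * r ^ 8 < r ^ 12 * r ^ 8"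
    using r_ge power_increasing[of 1 12 r] by (intro mult_strict_right_mono) auto
  then show "2 * mb < M" using n_ge by (simp add: mb_def M_def flip: power_add)
qed

lemma finite_vecs [simp]: "finite vecs" and finite_zs [simp]: "finite zs"
  by (auto simp: vecs_def zs_def intro: finite_PiE)

lemma card_vecs: "card vecs = N ^ n"
  by (simp add: vecs_def card_PiE)

lemma card_zs: "card zs = M"
  by (simp add: zs_def)

lemma ip_bounds:
  assumes "x \<in> vecs" "y \<in> vecs"
  shows "0 \<le> ip x y" "ip x y \<le> int (n * r ^ 20)"
proof -
  have b: "0 \<le> x j * y j \<and> x j * y j \<le> int (r ^ 20)" if "j < n" for j
  proof -
    have xy: "0 \<le> x j" "x j \<le> int N" "0 \<le> y j" "y j \<le> int N"
      using that assms by (force simp: vecs_def PiE_iff)+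
    have "x j * y j \<le> int N * int N" using xy by (intro mult_mono) auto
    also have "\<dots> = int (r ^ 20)" by (simp add: N_def flip: power_add)
    finally show ?thesis using xy by simp
  qed
  show "0 \<le> ip x y" unfolding ip_def using b by (intro sum_nonneg) blast
  have "ip x y \<le> (\<Sum>j<n. int (r ^ 20))"
    unfolding ip_def by (intro sum_mono) (use b in blast)
  then show "ip x y \<le> int (n * r ^ 20)" by simp
qed

definition Q :: real where "Q = 441 * real r ^ 15"

text \<open>This is the one-coordinate estimate for middle frequencies. The inner sums are
  geometric: \<open>\<bar>k\<bar> > la\<close> makes them decay like
  \<open>20 * r ^ 14 / \<bar>y - w\<bar>\<close>, and \<open>\<bar>k\<bar> \<le> mb\<close> keeps
  \<open>k * (y - w)\<close> away from multiples of \<open>M\<close>. The diagonal contributes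
  \<open>N\<close>, the rest a harmonic sum with \<open>ln N \<le> 10 * r\<close>. The trivial bound
  would be \<open>N ^ 2 = r ^ 20\<close>.\<close>

lemma sum_norm_chi_le_Q:
  assumes y: "y \<in> {0..<int N}" and k: "int la < \<bar>k\<bar>" "\<bar>k\<bar> \<le> int mb"
  shows "(\<Sum>w\<in>{0..<int N}. cmod (\<Sum>x\<in>{0..<int N}. chi M (k * (y - w) * x))) \<le> Q"
proof -
  let ?g = "\<lambda>d. cmod (\<Sum>x\<in>{0..<int N}. chi M (k * d * x))"
  have kr: "real la \<le> \<bar>real_of_int k\<bar>" using k by linarith
  have g: "?g d \<le> 20 * real r ^ 14 / \<bar>real_of_int d\<bar>" if d: "d \<noteq> 0" "\<bar>d\<bar> \<le> int N" for d
  proof -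
    have "\<bar>k * d\<bar> \<le> int mb * int N" using k d unfolding abs_mult by (intro mult_mono) auto
    also have "\<dots> \<le> int (n * r ^ 19)"
    proof -
      have "8 * r ^ 18 \<le> r * r ^ 18" using r_ge by (intro mult_right_mono) auto
      moreover have "8 * n * r ^ 8 * r ^ 10 = n * (8 * r ^ 18)" by (simp flip: power_add)
      moreover have "n * r ^ 19 = n * (r * r ^ 18)" by (simp flip: power_Suc)
      ultimately have "8 * n * r ^ 8 * r ^ 10 \<le> n * r ^ 19" by (simp only: mult_le_mono2)
      then show ?thesis by (simp add: mb_def N_def flip: of_nat_mult of_nat_power)
    qed
    finally have "real_of_int \<bar>k * d\<bar> \<le> real (n * r ^ 19)" by linarith
    also have "\<dots> \<le> 5/6 * real M"
    proof -
      have "n * r ^ 19 \<le> n * r ^ 20" using pow_le by simp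
      then have "real (n * r ^ 19) \<le> real (n * r ^ 20)" by (simp only: of_nat_le_iff)
      moreover have "5/6 * real M = 10/3 * real (n * r ^ 20)" by (simp add: M_def)
      moreover have "0 \<le> real (n * r ^ 20)" by simp
      ultimately show ?thesis by linarith
    qed
    finally have b: "\<bar>real_of_int (k * d)\<bar> \<le> 5/6 * real M" by simp
    have "?g d \<le> 5 * real M / \<bar>real_of_int (k * d)\<bar>"
      using norm_sum_chi_le[of M "k * d" 0 N] b d k params_pos by auto
    also have "\<dots> = 5 * real M / \<bar>real_of_int k\<bar> / \<bar>real_of_int d\<bar>" by (simp add: abs_mult)
    also have "\<dots> \<le> 5 * real M / real la / \<bar>real_of_int d\<bar>"
      using kr params_pos by (intro divide_right_mono divide_left_mono) auto
    also have "5 * real M / real la = 20 * real r ^ 14"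
      using params_pos n_ge by (simp add: M_def la_def field_simps flip: power_add)
    finally show ?thesis .
  qed
  have "(\<Sum>w\<in>{0..<int N}. ?g (y - w)) \<le> ?g 0 + (\<Sum>d=1..N. ?g (int d) + ?g (- int d))"
    by (rule sum_dist_le[OF _ y]) simp
  also have "\<dots> \<le> real N + (\<Sum>d=1..N. 40 * real r ^ 14 * (1 / real d))"
  proof (intro add_mono sum_mono)
    fix d assume "d \<in> {1..N}"
    then show "?g (int d) + ?g (- int d) \<le> 40 * real r ^ 14 * (1 / real d)"
      using g[of "int d"] g[of "- int d"] by auto
  qed simp
  also have "\<dots> \<le> real N + 40 * real r ^ 14 * (11 * real r)"
  proof -
    have "ln (real N) = 10 * ln (real r)" using params_pos by (simp add: N_def ln_realpow)
    also have "ln (real r) \<le> real r" using ln_le_minus_one[of "real r"] params_pos by simp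
    finally have "1 + ln (real N) \<le> 11 * real r" using r_ge by simp
    then have "(\<Sum>d=1..N. 1 / real d) \<le> 11 * real r" using harmonic_le_ln[of N] params_pos by linarith
    then show ?thesis unfolding sum_distrib_left[symmetric] by (intro add_left_mono mult_left_mono) auto
  qed
  also have "\<dots> \<le> Q"
  proof -
    have "real r ^ 10 \<le> real r ^ 15" using r_ge by (intro power_increasing) auto
    then show ?thesis by (simp add: N_def Q_def flip: power_Suc2 power_Suc)
  qed
  finally show ?thesis .
qed

lemma sum_vecs_prod: 
  fixes f :: "nat \<Rightarrow> int \<Rightarrow> 'c::comm_semiring_1"
  shows "(\<Sum>x\<in>vecs. \<Prod>j<n. f j (x j)) = (\<Prod>j<n. \<Sum>t\<in>{0..<int N}. f j t)"
  unfolding vecs_def by (rule prod_sum_PiE[symmetric]) auto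

text \<open>Once the square is expanded, the sum over \<open>x\<close> factors over the coordinates.
  Absolute values then remove the weights \<beta>, so the sum over the second vector
  \<open>y'\<close> factors as well, and each coordinate gives at most \<open>Q\<close>. Trivially
  the left side is at most \<open>N ^ (3 * n)\<close>; the gain per coordinate is
  \<open>N ^ 2 / Q\<close>.\<close>

lemma bilinear_character_bound:
  fixes \<beta> :: "(nat \<Rightarrow> int) \<Rightarrow> real"
  assumes k: "int la < \<bar>k\<bar>" "\<bar>k\<bar> \<le> int mb"
    and \<beta>: "\<And>y. y \<in> vecs \<Longrightarrow> 0 \<le> \<beta> y \<and> \<beta> y \<le> 1"
  shows "(\<Sum>x\<in>vecs. (cmod (\<Sum>y\<in>vecs. of_real (\<beta> y) * chi M (k * ip x y)))\<^sup>2) \<le> (real N * Q) ^ n"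
proof -
  let ?S = "\<lambda>y y'. \<Prod>j<n. \<Sum>t\<in>{0..<int N}. chi M (k * (y j - y' j) * t)"
  have "complex_of_real (\<Sum>x\<in>vecs. (cmod (\<Sum>y\<in>vecs. of_real (\<beta> y) * chi M (k * ip x y)))\<^sup>2)
      = (\<Sum>x\<in>vecs. \<Sum>y\<in>vecs. \<Sum>y'\<in>vecs. of_real (\<beta> y) * of_real (\<beta> y') * (\<Prod>j<n. chi M (k * (y j - y' j) * x j)))"
  proof -
    have "chi M (k * ip x y) * chi M (- (k * ip x y')) = (\<Prod>j<n. chi M (k * (y j - y' j) * x j))" for x y y'
      unfolding chi_add[symmetric] chi_sum[symmetric]
      by (simp add: ip_def sum_distrib_left right_diff_distrib left_diff_distrib sum_subtractf mult_ac)
    then have "of_real (\<beta> y) * chi M (k * ip x y) * cnj (of_real (\<beta> y') * chi M (k * ip x y'))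
       = of_real (\<beta> y) * of_real (\<beta> y') * (\<Prod>j<n. chi M (k * (y j - y' j) * x j))" for x y y'
      by (simp add: mult_ac flip: chi_minus)
    then show ?thesis unfolding of_real_sum complex_norm_square cnj_sum sum_product by (simp only:)
  qed
  also have "\<dots> = (\<Sum>y\<in>vecs. \<Sum>y'\<in>vecs. of_real (\<beta> y) * of_real (\<beta> y') * ?S y y')"
    unfolding sum_vecs_prod[symmetric] sum_distrib_left
    by (subst sum.swap, rule sum.cong[OF refl], subst sum.swap, rule refl)
  finally have eq: "complex_of_real (\<Sum>x\<in>vecs. (cmod (\<Sum>y\<in>vecs. of_real (\<beta> y) * chi M (k * ip x y)))\<^sup>2)
      = (\<Sum>y\<in>vecs. \<Sum>y'\<in>vecs. of_real (\<beta> y) * of_real (\<beta> y') * ?S y y')" .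
  have "(\<Sum>x\<in>vecs. (cmod (\<Sum>y\<in>vecs. of_real (\<beta> y) * chi M (k * ip x y)))\<^sup>2)
      = cmod (complex_of_real (\<Sum>x\<in>vecs. (cmod (\<Sum>y\<in>vecs. of_real (\<beta> y) * chi M (k * ip x y)))\<^sup>2))"
    unfolding norm_of_real by (simp add: sum_nonneg)
  also have "\<dots> \<le> (\<Sum>y\<in>vecs. \<Sum>y'\<in>vecs. cmod (of_real (\<beta> y) * of_real (\<beta> y') * ?S y y'))"
    unfolding eq by (rule order_trans[OF norm_sum], rule sum_mono, rule norm_sum)
  also have "\<dots> \<le> (\<Sum>y\<in>vecs. \<Sum>y'\<in>vecs. \<Prod>j<n. cmod (\<Sum>t\<in>{0..<int N}. chi M (k * (y j - y' j) * t)))"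
  proof (intro sum_mono)
    fix y y' assume y: "y \<in> vecs" "y' \<in> vecs"
    have "cmod (of_real (\<beta> y) * of_real (\<beta> y') * ?S y y') = \<beta> y * \<beta> y' * cmod (?S y y')"
      using \<beta> y by (simp add: norm_mult)
    also have "\<dots> \<le> 1 * cmod (?S y y')"
      using \<beta> y by (intro mult_right_mono mult_le_one) auto
    finally show "cmod (of_real (\<beta> y) * of_real (\<beta> y') * ?S y y') \<le> (\<Prod>j<n. cmod (\<Sum>t\<in>{0..<int N}. chi M (k * (y j - y' j) * t)))"
      by (simp add: prod_norm)
  qed
  also have "\<dots> = (\<Sum>y\<in>vecs. \<Prod>j<n. \<Sum>w\<in>{0..<int N}. cmod (\<Sum>t\<in>{0..<int N}. chi M (k * (y j - w) * t)))"
    by (rule sum.cong[OF refl], rule sum_vecs_prod[of "\<lambda>j w. cmod (\<Sum>t\<in>{0..<int N}. chi M (k * (_ j - w) * t))"])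
  also have "\<dots> \<le> (\<Sum>y\<in>vecs. \<Prod>j<n. Q)"
    using sum_norm_chi_le_Q[OF _ k]
    by (intro sum_mono prod_mono conjI sum_nonneg) (auto simp: vecs_def PiE_iff)
  also have "\<dots> = (real N * Q) ^ n" by (simp add: card_vecs power_mult_distrib)
  finally show ?thesis .
qed

end

section \<open>Splitting the difference of the densities by frequency\<close>

context lf_params begin

text \<open>
  The de la Vallee Poussin kernel: its Fourier coefficients are \<open>1\<close> up to \<open>a\<close> and \<open>0\<close> beyond \<open>b\<close>, so
  the difference of two of them has no low frequencies at all.
\<close>

definition vp :: "nat \<Rightarrow> nat \<Rightarrow> int \<Rightarrow> real" where
  "vp b a t = (real b * fejer M b t - real a * fejer M a t) / (real b - real a)"

definition vp_coeff :: "int \<Rightarrow> real" where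
  "vp_coeff k = (fejer_coeff mb k - fejer_coeff ma k) / (real mb - real ma) - (fejer_coeff lb k - fejer_coeff la k) / (real lb - real la)"

lemma vp_eqs: "vp mb ma t = (8 * fejer M mb t - fejer M ma t) / 7" "vp lb la t = (8 * fejer M lb t - fejer M la t) / 7"
proof -
  have *: "(8 * a * f - a * g) / (8 * a - a) = (8 * f - g) / 7" if "a > 0" for a f g :: real
    using that by (simp add: field_simps)
  have "real mb = 8 * real ma" "real lb = 8 * real la" by (auto simp: mb_def ma_def lb_def la_def)
  then show "vp mb ma t = (8 * fejer M mb t - fejer M ma t) / 7" "vp lb la t = (8 * fejer M lb t - fejer M la t) / 7"
    using *[of "real ma"] *[of "real la"] params_pos by (simp_all add: vp_def)
qed

lemma widths_less: "real ma < real mb" "real la < real lb"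
  using params_pos by (auto simp: mb_def ma_def lb_def la_def)

lemma vp_coeff_low: "\<bar>k\<bar> \<le> int la \<Longrightarrow> vp_coeff k = 0"
proof -
  assume k: "\<bar>k\<bar> \<le> int la"
  then have "\<bar>real_of_int k\<bar> \<le> real la" by linarith
  moreover have "real la \<le> real lb" "real la \<le> real ma" "real la \<le> real mb"
    using widths_le by auto
  ultimately show ?thesis
    using widths_less by (simp add: vp_coeff_def fejer_coeff_def max_def)
qed

lemma abs_vp_coeff_le: "\<bar>vp_coeff k\<bar> \<le> 1"
proof -
  have *: "0 \<le> (fejer_coeff b k - fejer_coeff a k) / (real b - real a) \<and> (fejer_coeff b k - fejer_coeff a k) / (real b - real a) \<le> 1"
    if "real a < real b" for a b
    using that by (auto simp: fejer_coeff_def max_def field_simps)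
  show ?thesis using *[OF widths_less(1)] *[OF widths_less(2)] unfolding vp_coeff_def by linarith
qed

lemma vp_fourier:
  "complex_of_real (real M * (vp mb ma t - vp lb la t)) =
    (\<Sum>k\<in>{- int mb..int mb}. of_real (vp_coeff k) * chi M (k * t))"
proof -
  have f: "complex_of_real (real M * (real m * fejer M m t)) =
    (\<Sum>k\<in>{- int mb..int mb}. of_real (fejer_coeff m k) * chi M (k * t))" if "m \<le> mb" for m
    using fejer_fourier[OF that params_pos(3), of t] by (simp add: mult_ac)
  have le: "lb \<le> mb" "la \<le> mb" using widths_le by auto
  have "complex_of_real (real M * (vp mb ma t - vp lb la t)) =
    (of_real (real M * (real mb * fejer M mb t)) - of_real (real M * (real ma * fejer M ma t))) / of_real (real mb - real ma)
    - (of_real (real M * (real lb * fejer M lb t)) - of_real (real M * (real la * fejer M la t))) / of_real (real lb - real la)"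
    by (simp add: vp_def right_diff_distrib)
  also have "\<dots> = (\<Sum>k\<in>{- int mb..int mb}. of_real (vp_coeff k) * chi M (k * t))"
    unfolding f[OF order_refl] f[OF widths_le(1)] f[OF le(1)] f[OF le(2)]
    unfolding sum_subtractf[symmetric] sum_divide_distrib left_diff_distrib[symmetric]
    by (intro sum.cong refl) (simp add: vp_coeff_def left_diff_distrib diff_divide_distrib)
  finally show ?thesis .
qed

text \<open>The middle-frequency part of the difference between the two densities, that of satisfied
  and that of violated constraints.\<close>

definition band :: "int \<Rightarrow> real" where
  "band t = (vp mb ma (t - T) - vp lb la (t - T)) - (vp mb ma (t + T) - vp lb la (t + T))"

definition band_coeff :: "int \<Rightarrow> complex" where
  "band_coeff k = of_real (vp_coeff k) * (chi M (- (k * T)) - chi M (k * T)) / of_nat M"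

lemma band_fourier: "complex_of_real (band t) = (\<Sum>k\<in>{- int mb..int mb}. band_coeff k * chi M (k * t))"
proof -
  have "complex_of_real (band t) =
     (complex_of_real (real M * (vp mb ma (t - T) - vp lb la (t - T))) - complex_of_real (real M * (vp mb ma (t + T) - vp lb la (t + T)))) / of_nat M"
    using params_pos by (simp add: band_def field_simps)
  also have "\<dots> = (\<Sum>k\<in>{- int mb..int mb}. band_coeff k * chi M (k * t))"
    unfolding vp_fourier sum_subtractf[symmetric] sum_divide_distrib
  proof (intro sum.cong refl)
    fix k
    have "chi M (k * (t - T)) = chi M (- (k * T)) * chi M (k * t)" "chi M (k * (t + T)) = chi M (k * T) * chi M (k * t)"
      by (simp_all add: algebra_simps flip: chi_add)
    then show "(complex_of_real (vp_coeff k) * chi M (k * (t - T)) - complex_of_real (vp_coeff k) * chi M (k * (t + T))) / of_nat M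
       = band_coeff k * chi M (k * t)"
      by (simp add: band_coeff_def algebra_simps)
  qed
  finally show ?thesis .
qed

lemma norm_band_coeff_le: "cmod (band_coeff k) \<le> 2 / real M"
proof -
  have "cmod (chi M (- (k * T)) - chi M (k * T)) \<le> 2"
    using norm_triangle_ineq4[of "chi M (- (k * T))" "chi M (k * T)"] by simp
  then have "\<bar>vp_coeff k\<bar> * cmod (chi M (- (k * T)) - chi M (k * T)) \<le> 1 * 2"
    using abs_vp_coeff_le by (intro mult_mono) auto
  then show ?thesis by (simp add: band_coeff_def norm_mult norm_divide divide_right_mono)
qed

text \<open>Bounds what the middle band contributes on one rectangle, per pair
  \<open>(x, y)\<close>. The square root comes from Cauchy-Schwarz; \<open>1000\<close> absorbs
  \<open>2 * 441\<close> and \<open>10\<close> absorbs the square root of \<open>96\<close>.\<close>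

definition \<delta> :: real where "\<delta> = 10 * sqrt (1000 / real r) ^ n"

text \<open>Parseval in \<open>z\<close> decouples the frequencies. Those up to \<open>la\<close>
  vanish because both kernels have coefficient \<open>1\<close> there, and the bilinear bound
  handles each of the others.\<close>

lemma band_second_moment:
  fixes \<beta> :: "(nat \<Rightarrow> int) \<Rightarrow> real"
  assumes \<beta>: "\<And>y. y \<in> vecs \<Longrightarrow> 0 \<le> \<beta> y \<and> \<beta> y \<le> 1"
  shows "(\<Sum>x\<in>vecs. \<Sum>z\<in>zs. (\<Sum>y\<in>vecs. \<beta> y * band (ip x y - z))\<^sup>2)
    \<le> 4 / real M * (2 * real mb + 1) * (real N * Q) ^ n"
proof -
  let ?I = "{- int mb..int mb}"
  let ?h = "\<lambda>k x. \<Sum>y\<in>vecs. complex_of_real (\<beta> y) * chi M (k * ip x y)"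
  have sq: "s\<^sup>2 = (cmod w)\<^sup>2" if "complex_of_real s = w" for s w
    unfolding that[symmetric] by simp
  have x: "(\<Sum>z\<in>zs. (\<Sum>y\<in>vecs. \<beta> y * band (ip x y - z))\<^sup>2)
     = real M * (\<Sum>k\<in>?I. (cmod (band_coeff k * ?h k x))\<^sup>2)" for x
  proof -
    have "complex_of_real (\<Sum>y\<in>vecs. \<beta> y * band (ip x y - z)) = (\<Sum>k\<in>?I. band_coeff k * ?h k x * chi M (k * (0 - z)))" for z
    proof -
      have "complex_of_real (\<Sum>y\<in>vecs. \<beta> y * band (ip x y - z)) =
         (\<Sum>y\<in>vecs. \<Sum>k\<in>?I. of_real (\<beta> y) * (band_coeff k * chi M (k * (ip x y - z))))"
        by (simp add: band_fourier sum_distrib_left)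
      also have "\<dots> = (\<Sum>k\<in>?I. \<Sum>y\<in>vecs. of_real (\<beta> y) * (band_coeff k * chi M (k * (ip x y - z))))"
        by (rule sum.swap)
      also have "\<dots> = (\<Sum>k\<in>?I. band_coeff k * ?h k x * chi M (k * (0 - z)))"
      proof (intro sum.cong refl)
        fix k
        have "chi M (k * (ip x y - z)) = chi M (k * ip x y) * chi M (k * (0 - z))" for y
          by (simp add: right_diff_distrib flip: chi_add)
        then show "(\<Sum>y\<in>vecs. of_real (\<beta> y) * (band_coeff k * chi M (k * (ip x y - z)))) = band_coeff k * ?h k x * chi M (k * (0 - z))"
          unfolding sum_distrib_left sum_distrib_right by (intro sum.cong refl) (simp add: mult_ac)
      qed
      finally show ?thesis .
    qed
    from sq[OF this] have "(\<Sum>y\<in>vecs. \<beta> y * band (ip x y - z))\<^sup>2 = (cmod (\<Sum>k\<in>?I. band_coeff k * ?h k x * chi M (k * (0 - z))))\<^sup>2" for z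
      .
    moreover have "k = k'" if "k \<in> ?I" "k' \<in> ?I" "int M dvd k - k'" for k k'
      using that widths_le(4) by (intro dvd_diff_small[of M]) auto
    then have "(\<Sum>z\<in>zs. (cmod (\<Sum>k\<in>?I. band_coeff k * ?h k x * chi M (k * (0 - z))))\<^sup>2)
        = real M * (\<Sum>k\<in>?I. (cmod (band_coeff k * ?h k x))\<^sup>2)"
      unfolding zs_def by (intro parseval params_pos) auto
    ultimately show ?thesis by (simp only:)
  qed
  have k: "(\<Sum>x\<in>vecs. (cmod (band_coeff k * ?h k x))\<^sup>2) \<le> (2 / real M)\<^sup>2 * (real N * Q) ^ n" if "k \<in> ?I" for k
  proof (cases "\<bar>k\<bar> \<le> int la")
    case True
    then show ?thesis using vp_coeff_low by (simp add: band_coeff_def Q_def)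
  next
    case False
    have "(\<Sum>x\<in>vecs. (cmod (band_coeff k * ?h k x))\<^sup>2) = (cmod (band_coeff k))\<^sup>2 * (\<Sum>x\<in>vecs. (cmod (?h k x))\<^sup>2)"
      by (simp only: norm_mult power_mult_distrib sum_distrib_left[symmetric])
    also have "\<dots> \<le> (2 / real M)\<^sup>2 * (real N * Q) ^ n"
      using False that by (intro mult_mono power_mono norm_band_coeff_le bilinear_character_bound \<beta>) (auto intro: sum_nonneg)
    finally show ?thesis .
  qed
  have "(\<Sum>x\<in>vecs. \<Sum>z\<in>zs. (\<Sum>y\<in>vecs. \<beta> y * band (ip x y - z))\<^sup>2)
     = real M * (\<Sum>k\<in>?I. \<Sum>x\<in>vecs. (cmod (band_coeff k * ?h k x))\<^sup>2)"
    unfolding x sum_distrib_left[symmetric] by (subst sum.swap) simp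
  also have "\<dots> \<le> real M * (\<Sum>k\<in>?I. (2 / real M)\<^sup>2 * (real N * Q) ^ n)"
    by (intro mult_left_mono sum_mono k) auto
  also have "\<dots> = real M * ((2 * real mb + 1) * ((2 / real M)\<^sup>2 * (real N * Q) ^ n))"
    by simp
  also have "\<dots> = 4 / real M * (2 * real mb + 1) * (real N * Q) ^ n"
    using params_pos by (simp add: power2_eq_square field_simps)
  finally show ?thesis .
qed

text \<open>The balance of exponents: per coordinate \<open>N * Q * N\<close> is of order
  \<open>r ^ 35\<close>, against \<open>N ^ 4 = r ^ 40\<close>.\<close>

lemma constants_le: "4 * (2 * real mb + 1) * (real N * Q) ^ n * real N ^ n \<le> (real N ^ (2 * n) * \<delta>)\<^sup>2"
proof -
  define R where "R = real r"
  have R: "R \<ge> 1000" using r_ge by (simp add: R_def)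
  have "4 * (2 * real mb + 1) \<le> 12 * real mb" using params_pos by simp
  also have "\<dots> = 96 * real n * R ^ 8" by (simp add: mb_def R_def)
  \<comment> \<open>The number of frequencies is charged to the coordinates, \<open>R ^ 4\<close> to
    each, which uses \<open>n \<ge> 2\<close>. Of the \<open>R ^ 5\<close> saved per coordinate a
    factor \<open>R\<close> remains.\<close>
  also have "\<dots> \<le> 96 * 2 ^ n * R ^ (4 * n)"
  proof (intro mult_mono)
    have "real n \<le> real (2 ^ n)" unfolding of_nat_le_iff using less_exp[of n] by (rule less_imp_le)
    then show "real n \<le> 2 ^ n" by simp
    show "R ^ 8 \<le> R ^ (4 * n)" using R n_ge by (intro power_increasing) auto
  qed (use R in auto)
  finally have 1: "4 * (2 * real mb + 1) \<le> 96 * 2 ^ n * R ^ (4 * n)" .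
  have "4 * (2 * real mb + 1) * (real N * Q) ^ n * real N ^ n \<le> (96 * 2 ^ n * R ^ (4 * n)) * (real N * Q) ^ n * real N ^ n"
    by (intro mult_right_mono 1) (auto simp: Q_def)
  also have "\<dots> = 96 * (2 * R ^ 4 * (R ^ 10 * (441 * R ^ 15)) * R ^ 10) ^ n"
  proof -
    have "R ^ (4 * n) = (R ^ 4) ^ n" by (simp only: power_mult)
    then show ?thesis
      unfolding N_def Q_def of_nat_power R_def[symmetric] by (simp only: power_mult_distrib mult_ac)
  qed
  also have "2 * R ^ 4 * (R ^ 10 * (441 * R ^ 15)) * R ^ 10 = 882 * R ^ 39"
  proof -
    have "R ^ 39 = R ^ 4 * (R ^ 10 * (R ^ 15 * R ^ 10))" by (simp flip: power_add)
    then show ?thesis by simp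
  qed
  also have "96 * (882 * R ^ 39) ^ n \<le> 100 * (1000 * R ^ 39) ^ n"
    using R by (intro mult_mono power_mono) auto
  also have "1000 * R ^ 39 = (R ^ 10) ^ 2 * (R ^ 10) ^ 2 * (1000 / R)"
  proof -
    have "R ^ 39 * R = R ^ 40" using power_Suc2[of R 39] by simp
    also have "\<dots> = (R ^ 10) ^ 2 * (R ^ 10) ^ 2" by (simp flip: power_mult power_add)
    finally have "R ^ 39 * R = (R ^ 10) ^ 2 * (R ^ 10) ^ 2" .
    then show ?thesis using R by (simp add: field_simps)
  qed
  also have "100 * ((R ^ 10) ^ 2 * (R ^ 10) ^ 2 * (1000 / R)) ^ n = (real N ^ (2 * n) * \<delta>)\<^sup>2"
  proof -
    define A where "A = ((R ^ 10)\<^sup>2) ^ n"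
    have sq: "(sqrt (1000 / R) ^ n)\<^sup>2 = (1000 / R) ^ n"
    proof -
      have "(sqrt (1000 / R) ^ n)\<^sup>2 = (sqrt (1000 / R))\<^sup>2 ^ n"
        by (simp only: power_mult[symmetric] mult.commute)
      then show ?thesis using R by simp
    qed
    have "(R ^ 10) ^ (2 * n) = A" by (simp only: A_def power_mult)
    then have "(real N ^ (2 * n) * \<delta>)\<^sup>2 = A\<^sup>2 * (100 * (sqrt (1000 / R) ^ n)\<^sup>2)"
      by (simp only: N_def \<delta>_def R_def of_nat_power power_mult_distrib) simp
    moreover have "((R ^ 10)\<^sup>2 * (R ^ 10)\<^sup>2 * (1000 / R)) ^ n = A\<^sup>2 * (1000 / R) ^ n"
      by (simp only: power_mult_distrib[of _ _ n] A_def power2_eq_square[of "((R ^ 10)\<^sup>2) ^ n"])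
    ultimately show ?thesis unfolding sq by simp
  qed
  finally show ?thesis .
qed

text \<open>Cauchy-Schwarz over the pairs \<open>(x, z)\<close> removes \<alpha>, whose squares sum
  to at most \<open>N ^ n * M\<close>, and leaves the second moment.\<close>

lemma band_rectangle:
  fixes \<alpha> :: "(nat \<Rightarrow> int) \<Rightarrow> int \<Rightarrow> real" and \<beta> :: "(nat \<Rightarrow> int) \<Rightarrow> real"
  assumes \<alpha>: "\<And>x z. x \<in> vecs \<Longrightarrow> z \<in> zs \<Longrightarrow> 0 \<le> \<alpha> x z \<and> \<alpha> x z \<le> 1"
    and \<beta>: "\<And>y. y \<in> vecs \<Longrightarrow> 0 \<le> \<beta> y \<and> \<beta> y \<le> 1"
  shows "\<bar>\<Sum>x\<in>vecs. \<Sum>z\<in>zs. \<alpha> x z * (\<Sum>y\<in>vecs. \<beta> y * band (ip x y - z))\<bar> \<le> real N ^ (2 * n) * \<delta>"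
proof -
  let ?g = "\<lambda>x z. \<Sum>y\<in>vecs. \<beta> y * band (ip x y - z)"
  have "(\<Sum>x\<in>vecs. \<Sum>z\<in>zs. \<alpha> x z * ?g x z)\<^sup>2 = (\<Sum>p\<in>vecs \<times> zs. \<alpha> (fst p) (snd p) * ?g (fst p) (snd p))\<^sup>2"
    by (simp add: sum.cartesian_product case_prod_beta)
  also have "\<dots> \<le> (\<Sum>p\<in>vecs \<times> zs. (\<alpha> (fst p) (snd p))\<^sup>2) * (\<Sum>p\<in>vecs \<times> zs. (?g (fst p) (snd p))\<^sup>2)"
    by (rule Cauchy_Schwarz_ineq_sum)
  also have "\<dots> \<le> (real N ^ n * real M) * (4 / real M * (2 * real mb + 1) * (real N * Q) ^ n)"
  proof (rule mult_mono)
    have "(\<Sum>p\<in>vecs \<times> zs. (\<alpha> (fst p) (snd p))\<^sup>2) \<le> (\<Sum>p\<in>vecs \<times> zs. 1)"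
      using \<alpha> by (intro sum_mono) (auto intro!: power_le_one)
    then show "(\<Sum>p\<in>vecs \<times> zs. (\<alpha> (fst p) (snd p))\<^sup>2) \<le> real N ^ n * real M"
      by (simp add: card_vecs card_zs)
    show "(\<Sum>p\<in>vecs \<times> zs. (?g (fst p) (snd p))\<^sup>2) \<le> 4 / real M * (2 * real mb + 1) * (real N * Q) ^ n"
      using band_second_moment[OF \<beta>] by (simp add: sum.cartesian_product case_prod_beta)
  qed (auto intro: sum_nonneg)
  also have "\<dots> = 4 * (2 * real mb + 1) * (real N * Q) ^ n * real N ^ n"
    using params_pos by simp
  also have "\<dots> \<le> (real N ^ (2 * n) * \<delta>)\<^sup>2"
    by (rule constants_le)
  finally show ?thesis
    unfolding power2_abs[symmetric, of "\<Sum>x\<in>vecs. _ x"]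
    by (rule power2_le_imp_le) (simp add: \<delta>_def)
qed

text \<open>Kernels of width at most \<open>lb\<close> vary on a scale of at least
  \<open>M / lb = r ^ 14 / 2\<close>, so the shift by \<open>T = r ^ 13\<close> is relatively of
  order \<open>1 / r\<close>.\<close>

lemma low_shift_le:
  "(\<Sum>z\<in>zs. \<bar>vp lb la (h - z - T) - vp lb la (h - z + T)\<bar>) \<le> 100 / real r"
proof -
  let ?D = "\<lambda>m z. \<bar>fejer M m (h - z - T) - fejer M m (h - z + T)\<bar>"
  have D: "(\<Sum>z\<in>zs. ?D m z) \<le> 64 / real r" if m: "0 < m" "m \<le> lb" for m
  proof -
    have "(\<Sum>z\<in>zs. ?D m z) \<le> 8 * pi * real m * \<bar>real_of_int T\<bar> / real M"
      unfolding zs_def using m widths_le by (intro fejer_shift_diff) auto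
    also have "\<dots> \<le> 8 * 4 * real lb * \<bar>real_of_int T\<bar> / real M"
      using m pi_less_4 by (intro divide_right_mono mult_right_mono mult_mono) auto
    also have "\<dots> = 64 / real r"
      using params_pos n_ge by (simp add: lb_def T_def M_def field_simps flip: power_add power_Suc)
    finally show ?thesis .
  qed
  have "(\<Sum>z\<in>zs. \<bar>vp lb la (h - z - T) - vp lb la (h - z + T)\<bar>) \<le> (\<Sum>z\<in>zs. 8 / 7 * ?D lb z + 1 / 7 * ?D la z)"
    by (intro sum_mono) (auto simp: vp_eqs abs_if field_simps)
  also have "\<dots> = 8 / 7 * (\<Sum>z\<in>zs. ?D lb z) + 1 / 7 * (\<Sum>z\<in>zs. ?D la z)"
    by (simp add: sum.distrib sum_distrib_left)
  also have "\<dots> \<le> 8 / 7 * (64 / real r) + 1 / 7 * (64 / real r)"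
    using D params_pos widths_le by (intro add_mono mult_left_mono) auto
  also have "\<dots> \<le> 100 / real r" using params_pos by (simp add: field_simps)
  finally show ?thesis .
qed

lemma sum_fejer_zs: "0 < m \<Longrightarrow> m \<le> M \<Longrightarrow> (\<Sum>z\<in>zs. fejer M m (h - z)) = 1"
  unfolding zs_def by (rule sum_fejer)

text \<open>The kernel decays quadratically beyond its scale \<open>r ^ 12 / 2\<close>, so the mass
  beyond \<open>T = r ^ 13\<close> is of order \<open>1 / r\<close>. Injectivity of
  \<open>abs\<close> lets each absolute value count once; in both uses \<open>S\<close> lies on one
  side of \<open>0\<close>.\<close>

lemma tail_sum_le:
  assumes S: "finite S" "\<And>t. t \<in> S \<Longrightarrow> T \<le> \<bar>t\<bar> \<and> \<bar>t\<bar> \<le> int (3 * n * r ^ 20) + T"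
    and inj: "inj_on abs S"
  shows "(\<Sum>t\<in>S. fejer M mb t) \<le> 25 / real r"
proof -
  have "2 \<le> r ^ 13" using r_ge power_increasing[of 1 13 r] by simp
  then have T: "2 \<le> T" unfolding T_def by linarith
  have "(\<Sum>t\<in>S. fejer M mb t) \<le> (\<Sum>t\<in>S. 25 * real M / real mb * (1 / (real_of_int \<bar>t\<bar>)\<^sup>2))"
  proof (intro sum_mono)
    fix t assume t: "t \<in> S"
    \<comment> \<open>\<open>T\<close> has to fit into the slack between \<open>3/4 * M\<close> and
      \<open>5/6 * M\<close>, which is \<open>n * r ^ 20 / 3\<close>.\<close>
    have "3 \<le> r ^ 7" using r_ge power_increasing[of 1 7 r] by simp
    then have "3 * (r ^ 13 * 1) \<le> r ^ 7 * (r ^ 13 * n)"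
      using n_ge by (intro mult_le_mono) auto
    also have "\<dots> = n * r ^ 20" by (simp add: mult.left_commute flip: power_add)
    finally have "3 * r ^ 13 \<le> n * r ^ 20" by simp
    then have "real (3 * r ^ 13) \<le> real (n * r ^ 20)" by (simp only: of_nat_le_iff)
    moreover have "real_of_int \<bar>t\<bar> \<le> real (3 * n * r ^ 20) + real_of_int T" using S(2)[OF t] by linarith
    ultimately have "\<bar>real_of_int t\<bar> \<le> 5/6 * real M" by (simp add: T_def M_def)
    moreover have "t \<noteq> 0" using S(2)[OF t] T by auto
    ultimately show "fejer M mb t \<le> 25 * real M / real mb * (1 / (real_of_int \<bar>t\<bar>)\<^sup>2)"
      using fejer_le[of mb M t] params_pos by simp
  qed
  also have "\<dots> = 25 * real M / real mb * (\<Sum>t\<in>abs ` S. 1 / (real_of_int t)\<^sup>2)"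
    using inj by (simp add: sum.reindex sum_distrib_left)
  also have "\<dots> \<le> 25 * real M / real mb * (2 / real_of_int T)"
    using S by (intro mult_left_mono sum_inverse_squares_le T) auto
  also have "\<dots> = 25 / real r"
    using params_pos n_ge by (simp add: mb_def T_def M_def field_simps flip: power_add power_Suc)
  finally show ?thesis .
qed

lemma wrong_label_plus:
  assumes "x \<in> vecs" "y \<in> vecs"
  shows "(\<Sum>z | z \<in> zs \<and> ip x y < z. fejer M mb (ip x y - z - T)) \<le> 25 / real r"
proof -
  let ?S = "{z \<in> zs. ip x y < z}" and ?f = "\<lambda>z. ip x y - z - T"
  have "(\<Sum>z\<in>?S. fejer M mb (?f z)) = (\<Sum>t\<in>?f ` ?S. fejer M mb t)"
    by (subst sum.reindex) (auto simp: inj_on_def)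
  also have "\<dots> \<le> 25 / real r"
  proof (rule tail_sum_le)
    show "finite (?f ` ?S)" by (intro finite_imageI finite_subset[OF _ finite_zs]) auto
  qed (use ip_bounds[OF assms] params_pos in \<open>auto simp: zs_def M_def inj_on_def\<close>)
  finally show ?thesis .
qed

lemma wrong_label_minus:
  assumes "x \<in> vecs" "y \<in> vecs"
  shows "(\<Sum>z | z \<in> zs \<and> z \<le> ip x y. fejer M mb (ip x y - z + T)) \<le> 25 / real r"
proof -
  let ?S = "{z \<in> zs. z \<le> ip x y}" and ?f = "\<lambda>z. ip x y - z + T"
  have "(\<Sum>z\<in>?S. fejer M mb (?f z)) = (\<Sum>t\<in>?f ` ?S. fejer M mb t)"
    by (subst sum.reindex) (auto simp: inj_on_def)
  also have "\<dots> \<le> 25 / real r"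
  proof (rule tail_sum_le)
    show "finite (?f ` ?S)" by (intro finite_imageI finite_subset[OF _ finite_zs]) auto
  qed (use ip_bounds[OF assms] params_pos in \<open>auto simp: zs_def M_def inj_on_def\<close>)
  finally show ?thesis .
qed

text \<open>The three parts are treated differently: the middle band is bounded rectangle by
  rectangle and so pays \<open>card V\<close>, while the other two use only that the total
  acceptance weight is between \<open>0\<close> and \<open>1\<close>.\<close>

theorem rectangles_cannot_distinguish:
  fixes \<alpha> :: "'v \<Rightarrow> (nat \<Rightarrow> int) \<Rightarrow> int \<Rightarrow> real" and \<beta> :: "'v \<Rightarrow> (nat \<Rightarrow> int) \<Rightarrow> real"
  assumes V: "finite V"
    and \<alpha>: "\<And>v x z. v \<in> V \<Longrightarrow> x \<in> vecs \<Longrightarrow> z \<in> zs \<Longrightarrow> 0 \<le> \<alpha> v x z \<and> \<alpha> v x z \<le> 1"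
    and \<beta>: "\<And>v y. v \<in> V \<Longrightarrow> y \<in> vecs \<Longrightarrow> 0 \<le> \<beta> v y \<and> \<beta> v y \<le> 1"
    and \<Phi>: "\<And>x z y. x \<in> vecs \<Longrightarrow> z \<in> zs \<Longrightarrow> y \<in> vecs \<Longrightarrow> (\<Sum>v\<in>V. \<alpha> v x z * \<beta> v y) \<le> 1"
  shows "(\<Sum>x\<in>vecs. \<Sum>z\<in>zs. \<Sum>y\<in>vecs. (fejer M mb (ip x y - z - T) - fejer M mb (ip x y - z + T)) * (\<Sum>v\<in>V. \<alpha> v x z * \<beta> v y))
    \<le> real N ^ (2 * n) * (1 / 8 + real (card V) * \<delta> + 100 / real r)"
proof -
  let ?P = "\<lambda>x z y. \<Sum>v\<in>V. \<alpha> v x z * \<beta> v y"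
  define \<Sigma> where "\<Sigma> f = (\<Sum>x\<in>vecs. \<Sum>z\<in>zs. \<Sum>y\<in>vecs. f (ip x y - z) * ?P x z y)" for f :: "int \<Rightarrow> real"
  have P: "0 \<le> ?P x z y" if "x \<in> vecs" "z \<in> zs" "y \<in> vecs" for x z y
    using that \<alpha> \<beta> by (intro sum_nonneg mult_nonneg_nonneg) auto
  have \<Sigma>_le: "\<Sigma> f \<le> real N ^ (2 * n) * c" if f: "\<And>h. (\<Sum>z\<in>zs. \<bar>f (h - z)\<bar>) \<le> c" for f c
  proof -
    have "\<Sigma> f \<le> (\<Sum>x\<in>vecs. \<Sum>z\<in>zs. \<Sum>y\<in>vecs. \<bar>f (ip x y - z)\<bar>)"
      unfolding \<Sigma>_def
    proof (intro sum_mono)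
      fix x z y assume *: "x \<in> vecs" "z \<in> zs" "y \<in> vecs"
      have "f (ip x y - z) * ?P x z y \<le> \<bar>f (ip x y - z)\<bar> * ?P x z y"
        using P[OF *] by (intro mult_right_mono) auto
      also have "\<dots> \<le> \<bar>f (ip x y - z)\<bar> * 1"
        using \<Phi>[OF *] by (intro mult_left_mono) auto
      finally show "f (ip x y - z) * ?P x z y \<le> \<bar>f (ip x y - z)\<bar>" by simp
    qed
    also have "\<dots> = (\<Sum>x\<in>vecs. \<Sum>y\<in>vecs. \<Sum>z\<in>zs. \<bar>f (ip x y - z)\<bar>)"
      by (intro sum.cong refl sum.swap)
    also have "\<dots> \<le> (\<Sum>x\<in>vecs. \<Sum>y\<in>vecs. c)"
      by (intro sum_mono f)
    also have "\<dots> = real N ^ (2 * n) * c"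
      by (simp add: card_vecs mult_2 power_add)
    finally show ?thesis .
  qed
  have band: "\<Sigma> band \<le> real N ^ (2 * n) * (real (card V) * \<delta>)"
  proof -
    have "\<Sigma> band = (\<Sum>v\<in>V. \<Sum>x\<in>vecs. \<Sum>z\<in>zs. \<alpha> v x z * (\<Sum>y\<in>vecs. \<beta> v y * band (ip x y - z)))"
    proof -
      have "\<Sigma> band = (\<Sum>x\<in>vecs. \<Sum>z\<in>zs. \<Sum>v\<in>V. \<Sum>y\<in>vecs. \<alpha> v x z * (\<beta> v y * band (ip x y - z)))"
        unfolding \<Sigma>_def sum_distrib_left
        by (intro sum.cong refl, subst sum.swap) (simp add: mult_ac)
      also have "\<dots> = (\<Sum>x\<in>vecs. \<Sum>v\<in>V. \<Sum>z\<in>zs. \<Sum>y\<in>vecs. \<alpha> v x z * (\<beta> v y * band (ip x y - z)))"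
        by (intro sum.cong refl sum.swap)
      finally show ?thesis unfolding sum_distrib_left by (subst (asm) sum.swap)
    qed
    also have "\<dots> \<le> (\<Sum>v\<in>V. real N ^ (2 * n) * \<delta>)"
    proof (rule sum_mono)
      fix v assume "v \<in> V"
      then have "\<bar>\<Sum>x\<in>vecs. \<Sum>z\<in>zs. \<alpha> v x z * (\<Sum>y\<in>vecs. \<beta> v y * band (ip x y - z))\<bar> \<le> real N ^ (2 * n) * \<delta>"
        using \<alpha> \<beta> by (intro band_rectangle) auto
      then show "(\<Sum>x\<in>vecs. \<Sum>z\<in>zs. \<alpha> v x z * (\<Sum>y\<in>vecs. \<beta> v y * band (ip x y - z))) \<le> real N ^ (2 * n) * \<delta>"
        by linarith
    qed
    finally show ?thesis by (simp add: mult.left_commute)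
  qed
  have low: "\<Sigma> (\<lambda>t. vp lb la (t - T) - vp lb la (t + T)) \<le> real N ^ (2 * n) * (100 / real r)"
    by (rule \<Sigma>_le) (rule low_shift_le)
  have wide: "\<Sigma> (\<lambda>t. fejer M ma (t - T)) \<le> real N ^ (2 * n) * 1"
  proof (rule \<Sigma>_le)
    fix h
    have "(\<Sum>z\<in>zs. fejer M ma (h - z - T)) = 1"
      using sum_fejer_zs[of ma "h - T"] params_pos widths_le by (simp add: algebra_simps)
    then show "(\<Sum>z\<in>zs. \<bar>fejer M ma (h - z - T)\<bar>) \<le> 1" by simp
  qed
  have wide': "0 \<le> \<Sigma> (\<lambda>t. fejer M ma (t + T))"
    unfolding \<Sigma>_def by (intro sum_nonneg mult_nonneg_nonneg[OF fejer_nonneg P])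
  have lin: "\<Sigma> f + \<Sigma> g = \<Sigma> (\<lambda>t. f t + g t)" "\<Sigma> f - \<Sigma> g = \<Sigma> (\<lambda>t. f t - g t)" "a * \<Sigma> f = \<Sigma> (\<lambda>t. a * f t)" for f g a
    unfolding \<Sigma>_def by (simp_all only: sum_distrib_left sum.distrib sum_subtractf distrib_right left_diff_distrib mult.assoc)
  have arith: "X \<le> 7 / 8 * (K * (a + b + 1 / 7))" if "8 / 7 * X \<le> K * a + K * b + 1 / 7 * (K * 1 - 0)" for X K a b :: real
  proof -
    have "K * (a + b + 1 / 7) = K * a + K * b + K / 7" by (simp add: distrib_left)
    moreover have "8 / 7 * X \<le> K * a + K * b + K / 7" using that by simp
    ultimately show ?thesis by simp
  qed
  \<comment> \<open>\<open>8 * fejer M mb = 7 * vp mb ma + fejer M ma\<close>; then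
    \<open>vp lb la\<close> is subtracted and added.\<close>
  have pt: "8 / 7 * (fejer M mb (t - T) - fejer M mb (t + T)) = band t + (vp lb la (t - T) - vp lb la (t + T))
      + 1 / 7 * (fejer M ma (t - T) - fejer M ma (t + T))" for t
    by (simp add: band_def vp_eqs(1) diff_divide_distrib right_diff_distrib)
  have "8 / 7 * \<Sigma> (\<lambda>t. fejer M mb (t - T) - fejer M mb (t + T)) =
    \<Sigma> band + \<Sigma> (\<lambda>t. vp lb la (t - T) - vp lb la (t + T)) + 1 / 7 * (\<Sigma> (\<lambda>t. fejer M ma (t - T)) - \<Sigma> (\<lambda>t. fejer M ma (t + T)))"
    by (simp only: lin pt)
  also have "\<dots> \<le> real N ^ (2 * n) * (real (card V) * \<delta>) + real N ^ (2 * n) * (100 / real r) + 1 / 7 * (real N ^ (2 * n) * 1 - 0)"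
    using band low wide wide' by (intro add_mono mult_left_mono diff_mono) auto
  finally have "\<Sigma> (\<lambda>t. fejer M mb (t - T) - fejer M mb (t + T)) \<le> 7 / 8 * (real N ^ (2 * n) * (real (card V) * \<delta> + 100 / real r + 1 / 7))"
    by (rule arith)
  also have "\<dots> \<le> real N ^ (2 * n) * (1 / 8 + real (card V) * \<delta> + 100 / real r)"
  proof -
    have "0 \<le> real (card V) * \<delta>" "0 \<le> 100 / real r" by (simp_all add: \<delta>_def)
    moreover have "7 / 8 * (p + q + 1 / 7) \<le> 1 / 8 + p + q" if "0 \<le> p" "0 \<le> q" for p q :: real
      using that by simp
    ultimately have "7 / 8 * (real (card V) * \<delta> + 100 / real r + 1 / 7) \<le> 1 / 8 + real (card V) * \<delta> + 100 / real r"
      by blast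
    then have "real N ^ (2 * n) * (7 / 8 * (real (card V) * \<delta> + 100 / real r + 1 / 7)) \<le> real N ^ (2 * n) * (1 / 8 + real (card V) * \<delta> + 100 / real r)"
      by (rule mult_left_mono) (rule zero_le_power, rule of_nat_0_le_iff)
    then show ?thesis unfolding mult.left_commute[of "7 / 8"] .
  qed
  finally show ?thesis unfolding \<Sigma>_def .
qed

end

section \<open>Cut and paste on a single link\<close>

definition accepts :: "protocol \<Rightarrow> lf_input \<Rightarrow> bool" where
  "accepts P X \<longleftrightarrow> (\<exists>T. complete_execution P X T \<and> answer P T)"

definition accepts_short :: "nat \<Rightarrow> nat \<Rightarrow> protocol \<Rightarrow> lf_input \<Rightarrow> bool" where
  "accepts_short l i P X \<longleftrightarrow>
     (\<exists>T. complete_execution P X T \<and> answer P T \<and> length (link_view i T) \<le> l)"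

definition consistent :: "protocol \<Rightarrow> nat \<Rightarrow> server_input \<Rightarrow> bool list \<Rightarrow> bool" where
  "consistent P i u v \<longleftrightarrow>
     (\<forall>k < length v. server_turn P i (take k v) \<longrightarrow> server_bit P i u (take k v) = v ! k)"

text \<open>Depends on the inputs of the servers other than \<open>i\<close> only.\<close>

definition rest_accepts :: "protocol \<Rightarrow> nat \<Rightarrow> bool list \<Rightarrow> lf_input \<Rightarrow> bool" where
  "rest_accepts P i v X \<longleftrightarrow>
     (\<exists>u T. complete_execution P (X[i := u]) T \<and> answer P T \<and> link_view i T = v)"

lemma link_view_Nil [simp]: "link_view i [] = []"
  by (simp add: link_view_def)

lemma link_view_snoc [simp]:
  "link_view i (T @ [(j, b)]) = link_view i T @ (if j = i then [b] else [])"
  by (simp add: link_view_def)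

lemma consistent_Nil [simp]: "consistent P i u []"
  by (simp add: consistent_def)

lemma consistent_snoc:
  "consistent P i u (v @ [b]) \<longleftrightarrow>
     consistent P i u v \<and> (server_turn P i v \<longrightarrow> server_bit P i u v = b)"
  by (auto simp: consistent_def nth_append less_Suc_eq)

lemma execution_consistent: "execution P X T \<Longrightarrow> consistent P i (X ! i) (link_view i T)"
  by (induction rule: execution.induct) (auto simp: consistent_snoc next_bit_def)

text \<open>The coordinator and the other servers see server \<open>i\<close> only through its link,
  so an input that would send the same bits there leaves the whole run unchanged.\<close>

lemma execution_replace:
  assumes "execution P X T" "consistent P i u (link_view i T)"
  shows "execution P (X[i := u]) T"
  using assms
proof (induction rule: execution.induct)
  case start
  show ?case by (rule execution.start)
next
  case (step T j)
  have "consistent P i u (link_view i T)"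
    using step.prems by (auto simp: consistent_snoc split: if_splits)
  then have "execution P (X[i := u]) T" by (rule step.IH)
  moreover have "next_bit P (X[i := u]) j T = next_bit P X j T"
    using step.prems step.hyps by (cases "j = i") (auto simp: next_bit_def consistent_snoc)
  ultimately show ?case
    using execution.step[of P "X[i := u]" T j] step.hyps by simp
qed

lemma complete_execution_replace:
  assumes "complete_execution P X T" "consistent P i u (link_view i T)"
  shows "complete_execution P (X[i := u]) T"
  using assms by (simp add: complete_execution_def execution_replace)

text \<open>The rectangle property: for a fixed content \<open>v\<close> of link \<open>i\<close>,
  accepting is a condition on the input of server \<open>i\<close> and a separate one on all other
  inputs, however long the other links are.\<close>

lemma accepts_view_iff:
  assumes "i < length X"
  shows "(\<exists>T. complete_execution P X T \<and> answer P T \<and> link_view i T = v) \<longleftrightarrow>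
     consistent P i (X ! i) v \<and> rest_accepts P i v X"
proof
  assume "\<exists>T. complete_execution P X T \<and> answer P T \<and> link_view i T = v"
  then obtain T where T: "complete_execution P X T" "answer P T" "link_view i T = v" by blast
  then have "consistent P i (X ! i) v"
    using execution_consistent by (auto simp: complete_execution_def)
  moreover have "rest_accepts P i v X"
    unfolding rest_accepts_def using T by (intro exI[of _ "X ! i"] exI[of _ T]) simp
  ultimately show "consistent P i (X ! i) v \<and> rest_accepts P i v X" by blast
next
  assume "consistent P i (X ! i) v \<and> rest_accepts P i v X"
  then obtain u T where T: "complete_execution P (X[i := u]) T" "answer P T" "link_view i T = v"
    and c: "consistent P i (X ! i) (link_view i T)" by (auto simp: rest_accepts_def)
  from complete_execution_replace[OF T(1), of i "X ! i"]
  have "complete_execution P (X[i := u, i := X ! i]) T" using c by blast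
  then show "\<exists>T. complete_execution P X T \<and> answer P T \<and> link_view i T = v"
    using T by auto
qed

lemma rest_accepts_update [simp]: "rest_accepts P i v (X[i := u]) = rest_accepts P i v X"
  by (simp add: rest_accepts_def)

lemma finite_bool_lists: "finite {v :: bool list. length v \<le> l}"
  using finite_lists_length_le[of "UNIV :: bool set" l] by simp

lemma card_bool_lists: "card {v :: bool list. length v \<le> l} \<le> 2 ^ (l + 1)"
proof -
  have "card {v :: bool list. length v \<le> l} = (\<Sum>i\<le>l. 2 ^ i)"
    using card_lists_length_le[of "UNIV :: bool set" l] by simp
  also have "\<dots> \<le> 2 ^ (l + 1)"
    by (induction l) auto
  finally show ?thesis .
qed

text \<open>The rectangles are disjoint because the run is unique: only the actual link content
  contributes.\<close>

lemma accepts_short_rectangles: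
  assumes "i < length X"
  shows "(of_bool (accepts_short l i P X) :: real) =
    (\<Sum>v | length v \<le> l. of_bool (consistent P i (X ! i) v) * of_bool (rest_accepts P i v X))"
proof -
  let ?Q = "\<lambda>v. \<exists>T. complete_execution P X T \<and> answer P T \<and> link_view i T = v"
  have Q: "(of_bool (consistent P i (X ! i) v) * of_bool (rest_accepts P i v X) :: real) = of_bool (?Q v)" for v
    unfolding accepts_view_iff[OF assms] by simp
  show ?thesis
  proof (cases "accepts_short l i P X")
    case True
    then obtain T where T: "complete_execution P X T" "answer P T" "length (link_view i T) \<le> l"
      by (auto simp: accepts_short_def)
    have "?Q v \<longleftrightarrow> v = link_view i T" for v
      using T complete_execution_unique by metis
    then have "(\<Sum>v | length v \<le> l. of_bool (?Q v) :: real) = (\<Sum>v | length v \<le> l. if v = link_view i T then 1 else 0)"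
      by (intro sum.cong) auto
    also have "\<dots> = 1" using T finite_bool_lists[of l] by simp
    finally show ?thesis unfolding Q using True by simp
  next
    case False
    then have "\<not> ?Q v" if "length v \<le> l" for v
      using that by (auto simp: accepts_short_def)
    then have "(\<Sum>v | length v \<le> l. of_bool (?Q v) :: real) = 0" by (intro sum.neutral) auto
    then show ?thesis unfolding Q using False by simp
  qed
qed

lemma sum_link_views_le:
  assumes "finite I"
  shows "(\<Sum>i\<in>I. length (link_view i T)) \<le> length T"
proof (induction T rule: rev_induct)
  case (snoc p T)
  have "(\<Sum>i\<in>I. length (link_view i (T @ [p]))) = (\<Sum>i\<in>I. length (link_view i T)) + (\<Sum>i\<in>I. if fst p = i then 1 else 0)"
    by (cases p) (auto simp flip: sum.distrib intro!: sum.cong)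
  also have "(\<Sum>i\<in>I. if fst p = i then 1 else (0::nat)) \<le> 1" using assms by simp
  finally show ?case using snoc by simp
qed simp

text \<open>Markov's inequality over the links: a link with more than \<open>l\<close> bits uses up
  at least \<open>l + 1\<close> of the \<open>B\<close> available ones.\<close>

lemma sum_accepts_short_ge:
  assumes T: "complete_execution P X T" "real (length T) \<le> B" and "finite I"
  shows "real (card I) * of_bool (accepts P X) - B / (real l + 1) \<le> (\<Sum>i\<in>I. of_bool (accepts_short l i P X))"
proof -
  have "of_bool (accepts P X) - real (length (link_view i T)) / (real l + 1) \<le> of_bool (accepts_short l i P X)" for i
  proof (cases "accepts P X \<and> \<not> accepts_short l i P X")
    case True
    then have "\<not> length (link_view i T) \<le> l"
      using T complete_execution_unique unfolding accepts_def accepts_short_def by metis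
    then have "real l + 1 \<le> real (length (link_view i T))" by linarith
    then have "1 \<le> real (length (link_view i T)) / (real l + 1)" by simp
    then show ?thesis using True by simp
  next
    case False
    have "0 \<le> real (length (link_view i T)) / (real l + 1)" by simp
    moreover have "(of_bool (accepts P X) :: real) \<le> of_bool (accepts_short l i P X)" using False by simp
    ultimately show ?thesis by linarith
  qed
  then have "(\<Sum>i\<in>I. of_bool (accepts P X) - real (length (link_view i T)) / (real l + 1)) \<le> (\<Sum>i\<in>I. of_bool (accepts_short l i P X))"
    by (intro sum_mono)
  moreover have "(\<Sum>i\<in>I. of_bool (accepts P X) - real (length (link_view i T)) / (real l + 1)) =
     real (card I) * of_bool (accepts P X) - real (\<Sum>i\<in>I. length (link_view i T)) / (real l + 1)"
    by (simp add: sum_subtractf sum_divide_distrib)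
  moreover have "real (\<Sum>i\<in>I. length (link_view i T)) \<le> B"
    using sum_link_views_le[OF assms(3), of T] T(2) by linarith
  then have "real (\<Sum>i\<in>I. length (link_view i T)) / (real l + 1) \<le> B / (real l + 1)"
    by (intro divide_right_mono) auto
  ultimately show ?thesis by linarith
qed

section \<open>The direct sum over the links\<close>

text \<open>The coordinates are independent, so redrawing one of them preserves the product
  distribution. This singles out one server while the others keep their inputs.\<close>

lemma sum_PiE_resample:
  fixes w :: "'u \<Rightarrow> real"
  assumes "finite I" "i \<in> I" "finite U" and w: "(\<Sum>u\<in>U. w u) = 1"
  shows "(\<Sum>\<rho>\<in>PiE I (\<lambda>_. U). (\<Prod>k\<in>I. w (\<rho> k)) * H \<rho>) =
    (\<Sum>\<rho>\<in>PiE I (\<lambda>_. U). (\<Prod>k\<in>I. w (\<rho> k)) * (\<Sum>u\<in>U. w u * H (\<rho>(i := u))))"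
proof -
  define J where "J = I - {i}"
  have J: "finite J" "i \<notin> J" "I = insert i J" using assms by (auto simp: J_def)
  have split: "(\<Sum>\<rho>\<in>PiE I (\<lambda>_. U). (\<Prod>k\<in>I. w (\<rho> k)) * G \<rho>) =
     (\<Sum>u\<in>U. \<Sum>\<rho>\<in>PiE J (\<lambda>_. U). w u * (\<Prod>k\<in>J. w (\<rho> k)) * G (\<rho>(i := u)))" for G
  proof -
    have prod: "(\<Prod>k\<in>I. w ((\<rho>(i := u)) k)) = w u * (\<Prod>k\<in>J. w (\<rho> k))" for \<rho> u
      unfolding J(3) using J(1,2) by (auto intro!: prod.cong)
    have "(\<Sum>\<rho>\<in>PiE I (\<lambda>_. U). (\<Prod>k\<in>I. w (\<rho> k)) * G \<rho>) =
       (\<Sum>p\<in>U \<times> PiE J (\<lambda>_. U). (\<Prod>k\<in>I. w (((snd p)(i := fst p)) k)) * G ((snd p)(i := fst p)))"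
      unfolding J(3) PiE_insert_eq
      by (subst sum.reindex[OF inj_combinator[OF J(2)]]) (simp add: case_prod_beta)
    also have "\<dots> = (\<Sum>u\<in>U. \<Sum>\<rho>\<in>PiE J (\<lambda>_. U). w u * (\<Prod>k\<in>J. w (\<rho> k)) * G (\<rho>(i := u)))"
      unfolding prod by (simp add: sum.cartesian_product case_prod_beta)
    finally show ?thesis .
  qed
  have "(\<Sum>\<rho>\<in>PiE I (\<lambda>_. U). (\<Prod>k\<in>I. w (\<rho> k)) * (\<Sum>u\<in>U. w u * H (\<rho>(i := u)))) =
     (\<Sum>u'\<in>U. \<Sum>\<rho>\<in>PiE J (\<lambda>_. U). w u' * (\<Prod>k\<in>J. w (\<rho> k)) * (\<Sum>u\<in>U. w u * H (\<rho>(i := u))))"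
    unfolding split by simp
  also have "\<dots> = (\<Sum>u'\<in>U. w u') * (\<Sum>\<rho>\<in>PiE J (\<lambda>_. U). (\<Prod>k\<in>J. w (\<rho> k)) * (\<Sum>u\<in>U. w u * H (\<rho>(i := u))))"
    unfolding sum_product by (simp only: mult.assoc)
  also have "\<dots> = (\<Sum>\<rho>\<in>PiE J (\<lambda>_. U). \<Sum>u\<in>U. w u * (\<Prod>k\<in>J. w (\<rho> k)) * H (\<rho>(i := u)))"
    unfolding w by (simp add: sum_distrib_left mult_ac)
  also have "\<dots> = (\<Sum>\<rho>\<in>PiE I (\<lambda>_. U). (\<Prod>k\<in>I. w (\<rho> k)) * H \<rho>)"
    unfolding split by (rule sum.swap)
  finally show ?thesis by simp
qed

text \<open>
  \<open>w y\<close> and \<open>w_minus y\<close> are the distributions of a satisfied and of a violated constraint given \<open>y\<close>,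
  up to a probability \<open>\<epsilon>\<close> of a wrong label.
\<close>

locale direct_sum =
  fixes s l :: nat and Y :: "'y set" and U :: "'u set"
    and w w_minus :: "'y \<Rightarrow> 'u \<Rightarrow> real" and ok :: "'y \<Rightarrow> 'u \<Rightarrow> bool" and u0 :: 'u
    and e0 :: "'y \<Rightarrow> server_input" and e :: "'u \<Rightarrow> server_input"
    and \<eta> \<epsilon> :: real
  assumes fin: "finite Y" "finite U" "Y \<noteq> {}"
    and w_nonneg: "\<And>y u. 0 \<le> w y u" and w_minus_nonneg: "\<And>y u. 0 \<le> w_minus y u"
    and w_sum: "\<And>y. y \<in> Y \<Longrightarrow> (\<Sum>u\<in>U. w y u) = 1"
    and w_minus_sum: "\<And>y. y \<in> Y \<Longrightarrow> (\<Sum>u\<in>U. w_minus y u) = 1"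
    and w_bad: "\<And>y. y \<in> Y \<Longrightarrow> (\<Sum>u | u \<in> U \<and> \<not> ok y u. w y u) \<le> \<epsilon>"
    and w_minus_good: "\<And>y. y \<in> Y \<Longrightarrow> (\<Sum>u | u \<in> U \<and> ok y u. w_minus y u) \<le> \<epsilon>"
    and u0: "u0 \<in> U" "\<And>y. y \<in> Y \<Longrightarrow> ok y u0"
    and indist: "\<And>\<alpha> \<beta>. \<lbrakk>\<And>v u. 0 \<le> \<alpha> v u \<and> \<alpha> v u \<le> 1;
        \<And>v y. y \<in> Y \<Longrightarrow> 0 \<le> \<beta> v y \<and> \<beta> v y \<le> 1;
        \<And>u y. u \<in> U \<Longrightarrow> y \<in> Y \<Longrightarrow> (\<Sum>v | length v \<le> l. \<alpha> (v :: bool list) u * \<beta> v y) \<le> 1\<rbrakk>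
      \<Longrightarrow> (\<Sum>y\<in>Y. \<Sum>u\<in>U. (w y u - w_minus y u) * (\<Sum>v | length v \<le> l. \<alpha> v u * \<beta> v y)) \<le> real (card Y) * \<eta>"
begin

definition servers :: "nat set" where "servers = {1..<s}"
definition \<Omega> :: "(nat \<Rightarrow> 'u) set" where "\<Omega> = PiE servers (\<lambda>_. U)"
definition W :: "'y \<Rightarrow> (nat \<Rightarrow> 'u) \<Rightarrow> real" where "W y \<rho> = (\<Prod>k\<in>servers. w y (\<rho> k))"
definition inst :: "'y \<Rightarrow> (nat \<Rightarrow> 'u) \<Rightarrow> lf_input" where
  "inst y \<rho> = e0 y # map (\<lambda>k. e (\<rho> k)) [1..<s]"
text \<open>
  The number of servers is not bounded in terms of \<open>\<epsilon>\<close>, so a union bound over the wrong labels is not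
  available. Instead, violated constraints are replaced by a trivial one.
\<close>

definition repair :: "'y \<Rightarrow> 'u \<Rightarrow> 'u" where "repair y u = (if ok y u then u else u0)"
definition good :: "'y \<Rightarrow> (nat \<Rightarrow> 'u) \<Rightarrow> lf_input" where "good y \<rho> = inst y (\<lambda>k. repair y (\<rho> k))"

lemma fin_servers [simp]: "finite servers" and fin_\<Omega> [simp]: "finite \<Omega>"
  using fin by (auto simp: servers_def \<Omega>_def intro: finite_PiE)

lemma length_inst: "i \<in> servers \<Longrightarrow> i < length (inst y \<rho>)"
  by (auto simp: inst_def servers_def)

lemma inst_update: "i \<in> servers \<Longrightarrow> (inst y \<rho>)[i := e u] = inst y (\<rho>(i := u))"
proof -
  assume "i \<in> servers"
  then obtain j where j: "i = Suc j" "Suc j < s" by (cases i) (auto simp: servers_def)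
  have "(map (\<lambda>k. e (\<rho> k)) [1..<s])[j := e u] = map (\<lambda>k. e ((\<rho>(i := u)) k)) [1..<s]"
    using j by (intro nth_equalityI) (auto simp: nth_list_update)
  then show ?thesis by (simp add: inst_def j)
qed

lemma W_nonneg [simp]: "0 \<le> W y \<rho>"
  by (simp add: W_def prod_nonneg w_nonneg)

lemma W_sum: "y \<in> Y \<Longrightarrow> (\<Sum>\<rho>\<in>\<Omega>. W y \<rho>) = 1"
  using prod_sum_PiE[of servers "\<lambda>_. U" "\<lambda>_. w y"] fin w_sum
  by (simp add: \<Omega>_def W_def)

lemma resample:
  assumes "i \<in> servers" "y \<in> Y"
  shows "(\<Sum>\<rho>\<in>\<Omega>. W y \<rho> * H \<rho>) = (\<Sum>\<rho>\<in>\<Omega>. W y \<rho> * (\<Sum>u\<in>U. w y u * H (\<rho>(i := u))))"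
  unfolding \<Omega>_def W_def using assms fin w_sum by (intro sum_PiE_resample) auto

text \<open>Given \<open>y\<close>, the constraint of server \<open>i\<close> can be redrawn without
  touching the others. The redrawn \<open>u\<close> is left unrepaired, which matters only if its
  label is wrong; undoing this single repair costs \<epsilon>, whatever the number of
  servers.\<close>

lemma short_good_le:
  assumes i: "i \<in> servers" and y: "y \<in> Y"
  shows "(\<Sum>\<rho>\<in>\<Omega>. W y \<rho> * of_bool (accepts_short l i P (good y \<rho>))) \<le>
    (\<Sum>\<rho>\<in>\<Omega>. W y \<rho> * (\<Sum>u\<in>U. w y u * of_bool (accepts_short l i P ((good y \<rho>)[i := e u])))) + \<epsilon>"
proof -
  let ?A = "\<lambda>\<rho> u. of_bool (accepts_short l i P ((good y \<rho>)[i := e u])) :: real"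
  have upd: "good y (\<rho>(i := u)) = (good y \<rho>)[i := e (repair y u)]" for \<rho> u
  proof -
    have "(\<lambda>k. repair y ((\<rho>(i := u)) k)) = (\<lambda>k. repair y (\<rho> k))(i := repair y u)" by auto
    then show ?thesis unfolding good_def inst_update[OF i] by simp
  qed
  have "(\<Sum>\<rho>\<in>\<Omega>. W y \<rho> * of_bool (accepts_short l i P (good y \<rho>))) =
     (\<Sum>\<rho>\<in>\<Omega>. W y \<rho> * (\<Sum>u\<in>U. w y u * ?A \<rho> (repair y u)))"
    unfolding resample[OF assms, of "\<lambda>\<rho>. of_bool (accepts_short l i P (good y \<rho>))"] upd ..
  also have "\<dots> \<le> (\<Sum>\<rho>\<in>\<Omega>. W y \<rho> * ((\<Sum>u\<in>U. w y u * ?A \<rho> u) + \<epsilon>))"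
  proof (intro sum_mono mult_left_mono W_nonneg)
    fix \<rho>
    have "(\<Sum>u\<in>U. w y u * ?A \<rho> (repair y u)) \<le> (\<Sum>u\<in>U. w y u * ?A \<rho> u + (if \<not> ok y u then w y u else 0))"
      using w_nonneg by (intro sum_mono) (auto simp: repair_def)
    also have "\<dots> = (\<Sum>u\<in>U. w y u * ?A \<rho> u) + (\<Sum>u | u \<in> U \<and> \<not> ok y u. w y u)"
      using fin by (simp add: sum.distrib sum.inter_filter)
    also have "\<dots> \<le> (\<Sum>u\<in>U. w y u * ?A \<rho> u) + \<epsilon>" using w_bad[OF y] by simp
    finally show "(\<Sum>u\<in>U. w y u * ?A \<rho> (repair y u)) \<le> (\<Sum>u\<in>U. w y u * ?A \<rho> u) + \<epsilon>" .
  qed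
  also have "\<dots> = (\<Sum>\<rho>\<in>\<Omega>. W y \<rho> * (\<Sum>u\<in>U. w y u * ?A \<rho> u)) + (\<Sum>\<rho>\<in>\<Omega>. W y \<rho>) * \<epsilon>"
    by (simp add: distrib_left sum.distrib sum_distrib_right)
  finally show ?thesis unfolding W_sum[OF y] by simp
qed

text \<open>Here the two-party bound is applied to one link: \<alpha> says whether server
  \<open>i\<close> would produce \<open>v\<close>, and \<beta> is the probability, over the other
  servers, that the rest accepts with \<open>v\<close>. By independence given \<open>y\<close>,
  \<beta> depends on \<open>y\<close> alone.\<close>

lemma short_indist:
  assumes i: "i \<in> servers"
  shows "(\<Sum>y\<in>Y. \<Sum>\<rho>\<in>\<Omega>. W y \<rho> * (\<Sum>u\<in>U. (w y u - w_minus y u) * of_bool (accepts_short l i P ((good y \<rho>)[i := e u]))))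
    \<le> real (card Y) * \<eta>"
proof -
  let ?V = "{v :: bool list. length v \<le> l}"
  define \<alpha> :: "bool list \<Rightarrow> 'u \<Rightarrow> real" where "\<alpha> v u = of_bool (consistent P i (e u) v)" for v u
  define \<beta> where "\<beta> v y = (\<Sum>\<rho>\<in>\<Omega>. W y \<rho> * of_bool (rest_accepts P i v (good y \<rho>)))" for v y
  have len: "i < length (good y \<rho>)" for y \<rho> using length_inst[OF i] by (simp add: good_def)
  have \<Phi>: "(\<Sum>\<rho>\<in>\<Omega>. W y \<rho> * of_bool (accepts_short l i P ((good y \<rho>)[i := e u]))) = (\<Sum>v\<in>?V. \<alpha> v u * \<beta> v y)" for y u
  proof -
    have "(\<Sum>\<rho>\<in>\<Omega>. W y \<rho> * of_bool (accepts_short l i P ((good y \<rho>)[i := e u]))) =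
      (\<Sum>\<rho>\<in>\<Omega>. \<Sum>v\<in>?V. \<alpha> v u * (W y \<rho> * of_bool (rest_accepts P i v (good y \<rho>))))"
      using len by (simp add: accepts_short_rectangles \<alpha>_def sum_distrib_left mult_ac del: of_bool_eq_iff)
    also have "\<dots> = (\<Sum>v\<in>?V. \<alpha> v u * \<beta> v y)"
      unfolding \<beta>_def sum_distrib_left by (rule sum.swap)
    finally show ?thesis .
  qed
  have le1: "(\<Sum>\<rho>\<in>\<Omega>. W y \<rho> * of_bool (Q \<rho>)) \<le> 1" if "y \<in> Y" for y Q
  proof -
    have "(\<Sum>\<rho>\<in>\<Omega>. W y \<rho> * of_bool (Q \<rho>)) \<le> (\<Sum>\<rho>\<in>\<Omega>. W y \<rho>)" by (intro sum_mono) auto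
    then show ?thesis using W_sum[OF that] by simp
  qed
  have "(\<Sum>y\<in>Y. \<Sum>\<rho>\<in>\<Omega>. W y \<rho> * (\<Sum>u\<in>U. (w y u - w_minus y u) * of_bool (accepts_short l i P ((good y \<rho>)[i := e u]))))
     = (\<Sum>y\<in>Y. \<Sum>u\<in>U. (w y u - w_minus y u) * (\<Sum>\<rho>\<in>\<Omega>. W y \<rho> * of_bool (accepts_short l i P ((good y \<rho>)[i := e u]))))"
    unfolding sum_distrib_left by (intro sum.cong refl, subst sum.swap) (simp only: mult.left_commute)
  also have "\<dots> = (\<Sum>y\<in>Y. \<Sum>u\<in>U. (w y u - w_minus y u) * (\<Sum>v\<in>?V. \<alpha> v u * \<beta> v y))"
    unfolding \<Phi> ..
  also have "\<dots> \<le> real (card Y) * \<eta>"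
  proof (rule indist)
    show "0 \<le> \<alpha> v u \<and> \<alpha> v u \<le> 1" for v u by (simp add: \<alpha>_def)
    show "0 \<le> \<beta> v y \<and> \<beta> v y \<le> 1" if "y \<in> Y" for v y
      using le1[OF that] by (auto simp: \<beta>_def intro!: sum_nonneg)
    show "(\<Sum>v\<in>?V. \<alpha> v u * \<beta> v y) \<le> 1" if "u \<in> U" "y \<in> Y" for u y
      using le1[OF that(2)] by (simp flip: \<Phi>)
  qed
  finally show ?thesis .
qed

text \<open>Compares a repaired instance with the same instance after one constraint, on link
  \<open>i\<close>, is redrawn from the violated distribution. It is summed over links and over
  \<open>Y\<close> without normalisation, and it refers to untruncated acceptance, so that
  correctness of the protocol applies to it.\<close>

definition advantage :: "protocol \<Rightarrow> real" where
  "advantage P = (\<Sum>i\<in>servers. \<Sum>y\<in>Y. \<Sum>\<rho>\<in>\<Omega>. W y \<rho> *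
     (of_bool (accepts P (good y \<rho>)) - (\<Sum>u\<in>U. w_minus y u * of_bool (accepts P ((good y \<rho>)[i := e u])))))"

text \<open>Restricting to short links costs \<open>B / (l + 1)\<close> on the repaired side. On the
  violated side short acceptance implies acceptance, which is the favourable direction. In between
  lie \<epsilon> for the missing repair and \<eta> for swapping the two distributions.\<close>

lemma advantage_le:
  assumes short: "\<And>y \<rho>. y \<in> Y \<Longrightarrow> (\<And>k. k \<in> servers \<Longrightarrow> \<rho> k \<in> U) \<Longrightarrow>
      \<exists>T. complete_execution P (inst y \<rho>) T \<and> real (length T) \<le> B"
  shows "advantage P \<le> real (card Y) * (real (s - 1) * (\<eta> + \<epsilon>) + B / (real l + 1))"
proof -
  let ?S = "\<lambda>i y \<rho>. of_bool (accepts_short l i P (good y \<rho>)) :: real"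
  let ?R = "\<lambda>i y \<rho> u. of_bool (accepts_short l i P ((good y \<rho>)[i := e u])) :: real"
  have card: "card servers = s - 1" by (simp add: servers_def)
  have 1: "(\<Sum>i\<in>servers. \<Sum>y\<in>Y. \<Sum>\<rho>\<in>\<Omega>. W y \<rho> * of_bool (accepts P (good y \<rho>))) - real (card Y) * (B / (real l + 1))
     \<le> (\<Sum>i\<in>servers. \<Sum>y\<in>Y. \<Sum>\<rho>\<in>\<Omega>. W y \<rho> * ?S i y \<rho>)"
  proof -
    have "(\<Sum>i\<in>servers. \<Sum>y\<in>Y. \<Sum>\<rho>\<in>\<Omega>. W y \<rho> * of_bool (accepts P (good y \<rho>))) - real (card Y) * (B / (real l + 1))
      = (\<Sum>y\<in>Y. \<Sum>\<rho>\<in>\<Omega>. W y \<rho> * (real (card servers) * of_bool (accepts P (good y \<rho>)) - B / (real l + 1)))"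
    proof -
      have "(\<Sum>\<rho>\<in>\<Omega>. W y \<rho> * (real (card servers) * of_bool (accepts P (good y \<rho>)) - B / (real l + 1)))
        = real (card servers) * (\<Sum>\<rho>\<in>\<Omega>. W y \<rho> * of_bool (accepts P (good y \<rho>))) - B / (real l + 1)" if "y \<in> Y" for y
        using W_sum[OF that] by (simp add: right_diff_distrib sum_subtractf mult.left_commute flip: sum_distrib_left sum_distrib_right sum_divide_distrib)
      then show ?thesis by (simp add: sum_subtractf sum_distrib_left)
    qed
    also have "\<dots> \<le> (\<Sum>y\<in>Y. \<Sum>\<rho>\<in>\<Omega>. W y \<rho> * (\<Sum>i\<in>servers. ?S i y \<rho>))"
    proof (intro sum_mono mult_left_mono W_nonneg)
      fix y \<rho> assume y: "y \<in> Y" and \<rho>: "\<rho> \<in> \<Omega>"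
      have "repair y (\<rho> k) \<in> U" if "k \<in> servers" for k
        using \<rho> that u0 by (auto simp: repair_def \<Omega>_def)
      then obtain T where "complete_execution P (good y \<rho>) T" "real (length T) \<le> B"
        using short[OF y, of "\<lambda>k. repair y (\<rho> k)"] by (auto simp: good_def)
      then show "real (card servers) * of_bool (accepts P (good y \<rho>)) - B / (real l + 1) \<le> (\<Sum>i\<in>servers. ?S i y \<rho>)"
        by (rule sum_accepts_short_ge) simp
    qed
    also have "\<dots> = (\<Sum>y\<in>Y. \<Sum>i\<in>servers. \<Sum>\<rho>\<in>\<Omega>. W y \<rho> * ?S i y \<rho>)"
      unfolding sum_distrib_left by (intro sum.cong refl sum.swap)
    also have "\<dots> = (\<Sum>i\<in>servers. \<Sum>y\<in>Y. \<Sum>\<rho>\<in>\<Omega>. W y \<rho> * ?S i y \<rho>)"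
      by (rule sum.swap)
    finally show ?thesis .
  qed
  have 2: "(\<Sum>y\<in>Y. \<Sum>\<rho>\<in>\<Omega>. W y \<rho> * ?S i y \<rho>) \<le>
    (\<Sum>y\<in>Y. \<Sum>\<rho>\<in>\<Omega>. W y \<rho> * (\<Sum>u\<in>U. w_minus y u * of_bool (accepts P ((good y \<rho>)[i := e u])))) + real (card Y) * (\<eta> + \<epsilon>)"
    if i: "i \<in> servers" for i
  proof -
    have "(\<Sum>y\<in>Y. \<Sum>\<rho>\<in>\<Omega>. W y \<rho> * ?S i y \<rho>) \<le> (\<Sum>y\<in>Y. (\<Sum>\<rho>\<in>\<Omega>. W y \<rho> * (\<Sum>u\<in>U. w y u * ?R i y \<rho> u)) + \<epsilon>)"
      using short_good_le[OF i] by (intro sum_mono)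
    also have "\<dots> = (\<Sum>y\<in>Y. \<Sum>\<rho>\<in>\<Omega>. W y \<rho> * (\<Sum>u\<in>U. w_minus y u * ?R i y \<rho> u))
        + (\<Sum>y\<in>Y. \<Sum>\<rho>\<in>\<Omega>. W y \<rho> * (\<Sum>u\<in>U. (w y u - w_minus y u) * ?R i y \<rho> u)) + real (card Y) * \<epsilon>"
      by (simp add: left_diff_distrib right_diff_distrib sum_subtractf sum.distrib)
    also have "\<dots> \<le> (\<Sum>y\<in>Y. \<Sum>\<rho>\<in>\<Omega>. W y \<rho> * (\<Sum>u\<in>U. w_minus y u * of_bool (accepts P ((good y \<rho>)[i := e u]))))
        + real (card Y) * \<eta> + real (card Y) * \<epsilon>"
    proof (intro add_mono sum_mono mult_left_mono W_nonneg w_minus_nonneg short_indist[OF i] order_refl)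
      show "?R i y \<rho> u \<le> of_bool (accepts P ((good y \<rho>)[i := e u]))" for y \<rho> u
        by (auto simp: accepts_def accepts_short_def)
    qed simp
    finally show ?thesis by (simp add: distrib_left)
  qed
  have "(\<Sum>i\<in>servers. \<Sum>y\<in>Y. \<Sum>\<rho>\<in>\<Omega>. W y \<rho> * ?S i y \<rho>) \<le>
    (\<Sum>i\<in>servers. (\<Sum>y\<in>Y. \<Sum>\<rho>\<in>\<Omega>. W y \<rho> * (\<Sum>u\<in>U. w_minus y u * of_bool (accepts P ((good y \<rho>)[i := e u])))) + real (card Y) * (\<eta> + \<epsilon>))"
    by (intro sum_mono 2)
  with 1 show ?thesis
    by (simp add: advantage_def right_diff_distrib sum_subtractf sum.distrib card distrib_left mult.left_commute)
qed

end

section \<open>From acceptance probabilities to communication\<close>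

lemma integrable_of_bool [simp]: "integrable (measure_pmf R) (\<lambda>P. of_bool (Q P) :: real)"
  by (rule measure_pmf.integrable_const_bound[where B = 1]) auto

lemma expectation_of_bool: "measure_pmf.expectation R (\<lambda>P. of_bool (Q P) :: real) = measure_pmf.prob R {P. Q P}"
proof -
  have "(\<lambda>P. of_bool (Q P) :: real) = indicator {P. Q P}" by (auto simp: indicator_def)
  then show ?thesis by simp
qed

lemma prob_accepts_feasible:
  assumes "solves_LF d I R" "X \<in> I" "feasible d X"
  shows "measure_pmf.prob R {P. accepts P X} \<ge> 2 / 3"
proof -
  have "measure_pmf.prob R {P. \<exists>T. complete_execution P X T \<and> (answer P T \<longleftrightarrow> feasible d X)} \<ge> 2 / 3"
    using assms(1,2) unfolding solves_LF_def by blast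
  then show ?thesis using assms(3) by (simp add: accepts_def)
qed

lemma prob_accepts_infeasible:
  assumes "solves_LF d I R" "X \<in> I" "\<not> feasible d X"
  shows "measure_pmf.prob R {P. accepts P X} \<le> 1 / 3"
proof -
  let ?N = "{P. \<exists>T. complete_execution P X T \<and> \<not> answer P T}"
  have "measure_pmf.prob R {P. \<exists>T. complete_execution P X T \<and> (answer P T \<longleftrightarrow> feasible d X)} \<ge> 2 / 3"
    using assms(1,2) unfolding solves_LF_def by blast
  then have "measure_pmf.prob R ?N \<ge> 2 / 3" using assms(3) by simp
  \<comment> \<open>A protocol cannot both accept and reject, since its complete run is
    unique.\<close>
  moreover have "{P. accepts P X} \<subseteq> - ?N"
    using complete_execution_unique by (auto simp: accepts_def)
  then have "measure_pmf.prob R {P. accepts P X} \<le> measure_pmf.prob R (- ?N)"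
    by (intro measure_pmf.finite_measure_mono) auto
  moreover have "measure_pmf.prob R (- ?N) = 1 - measure_pmf.prob R ?N"
    using measure_pmf.prob_compl[of ?N R] by (simp add: Compl_eq_Diff_UNIV)
  ultimately show ?thesis by simp
qed

context direct_sum begin

text \<open>Correctness forces an expected advantage of at least \<open>1 / 3 - \<epsilon>\<close>
  per link and point, whereas cheap protocols have less by \<open>advantage_le\<close>. One
  \<epsilon> comes from the missing repair, the other from violated draws that happen to be
  satisfied.\<close>

theorem comm_lower_bound:
  assumes solves: "solves_LF d I R"
    and I: "\<And>y \<rho>. y \<in> Y \<Longrightarrow> (\<And>k. k \<in> servers \<Longrightarrow> \<rho> k \<in> U) \<Longrightarrow> inst y \<rho> \<in> I"
    and feas: "\<And>y \<rho>. y \<in> Y \<Longrightarrow> (\<And>k. k \<in> servers \<Longrightarrow> \<rho> k \<in> U) \<Longrightarrow>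
      feasible d (inst y \<rho>) \<longleftrightarrow> (\<forall>k\<in>servers. ok y (\<rho> k))"
    and B: "B \<le> (real l + 1) * (real (s - 1) * (1 / 3 - \<eta> - 2 * \<epsilon>))" and "s \<ge> 2"
  shows "comm_at_least B I R"
proof (rule ccontr)
  assume no: "\<not> comm_at_least B I R"
  define K where "K = real (card Y) * real (s - 1)"
  have K: "K > 0" using fin \<open>s \<ge> 2\<close> by (auto simp: K_def card_gt_0_iff)
  \<comment> \<open>Lengths are integers, so being below \<open>B\<close> gives one bound
    \<open>B' < B\<close> for all runs, and strictness survives the expectation.\<close>
  obtain B' where B': "B' < B" "\<And>P X T. P \<in> set_pmf R \<Longrightarrow> X \<in> I \<Longrightarrow> complete_execution P X T \<Longrightarrow> real (length T) \<le> B'"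
  proof
    show "real_of_int (\<lceil>B\<rceil> - 1) < B" by linarith
    fix P X T assume "P \<in> set_pmf R" "X \<in> I" "complete_execution P X T"
    then have "\<not> B \<le> real (length T)" using no unfolding comm_at_least_def by blast
    then have "int (length T) < \<lceil>B\<rceil>" by (simp add: less_ceiling_iff)
    then show "real (length T) \<le> real_of_int (\<lceil>B\<rceil> - 1)" by linarith
  qed
  have "advantage P \<le> real (card Y) * (real (s - 1) * (\<eta> + \<epsilon>) + B' / (real l + 1))" if P: "P \<in> set_pmf R" for P
  proof (rule advantage_le)
    fix y and \<rho> :: "nat \<Rightarrow> 'u" assume *: "y \<in> Y" "\<And>k. k \<in> servers \<Longrightarrow> \<rho> k \<in> U"
    then have X: "inst y \<rho> \<in> I" by (rule I)
    then have "\<exists>T. complete_execution P (inst y \<rho>) T"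
      using solves P by (auto simp: solves_LF_def)
    then show "\<exists>T. complete_execution P (inst y \<rho>) T \<and> real (length T) \<le> B'"
      using B'(2)[OF P X] by blast
  qed
  then have "measure_pmf.expectation R advantage \<le> real (card Y) * (real (s - 1) * (\<eta> + \<epsilon>) + B' / (real l + 1))"
    unfolding advantage_def by (intro measure_pmf.integral_le_const) (auto intro!: Bochner_Integration.integrable_sum AE_pmfI)
  also have "\<dots> < real (card Y) * (real (s - 1) * (\<eta> + \<epsilon>) + real (s - 1) * (1 / 3 - \<eta> - 2 * \<epsilon>))"
  proof -
    have "B' < (real l + 1) * (real (s - 1) * (1 / 3 - \<eta> - 2 * \<epsilon>))" using B' B by linarith
    then have "B' / (real l + 1) < real (s - 1) * (1 / 3 - \<eta> - 2 * \<epsilon>)"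
      by (simp add: divide_less_eq mult.commute)
    then show ?thesis using fin by (intro mult_strict_left_mono) (auto simp: card_gt_0_iff)
  qed
  also have "\<dots> = K * (1 / 3 - \<epsilon>)" by (simp add: K_def algebra_simps)
  finally have upper: "measure_pmf.expectation R advantage < K * (1 / 3 - \<epsilon>)" .
  have "K * (1 / 3 - \<epsilon>) = (\<Sum>i\<in>servers. \<Sum>y\<in>Y. \<Sum>\<rho>\<in>\<Omega>. W y \<rho> * (2 / 3 - (1 / 3 + \<epsilon>)))"
    using W_sum by (simp add: K_def servers_def flip: sum_distrib_right)
  also have "\<dots> \<le> (\<Sum>i\<in>servers. \<Sum>y\<in>Y. \<Sum>\<rho>\<in>\<Omega>. W y \<rho> *
     (measure_pmf.prob R {P. accepts P (good y \<rho>)} - (\<Sum>u\<in>U. w_minus y u * measure_pmf.prob R {P. accepts P ((good y \<rho>)[i := e u])})))"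
  proof (intro sum_mono mult_left_mono W_nonneg diff_mono)
    fix i y \<rho> assume i: "i \<in> servers" and y: "y \<in> Y" and \<rho>: "\<rho> \<in> \<Omega>"
    have rep: "repair y (\<rho> k) \<in> U \<and> ok y (repair y (\<rho> k))" if "k \<in> servers" for k
      using \<rho> that u0 y by (auto simp: repair_def \<Omega>_def)
    show "2 / 3 \<le> measure_pmf.prob R {P. accepts P (good y \<rho>)}"
      unfolding good_def using rep feas[OF y] I[OF y] by (intro prob_accepts_feasible[OF solves]) auto
    let ?p = "\<lambda>u. measure_pmf.prob R {P. accepts P ((good y \<rho>)[i := e u])}"
    have p: "?p u \<le> 1 / 3" if u: "u \<in> U" "\<not> ok y u" for u
    proof -
      let ?\<rho> = "(\<lambda>k. repair y (\<rho> k))(i := u)"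
      have *: "?\<rho> k \<in> U" if "k \<in> servers" for k using rep that u by auto
      have "feasible d (inst y ?\<rho>) \<longleftrightarrow> (\<forall>k\<in>servers. ok y (?\<rho> k))" by (rule feas[OF y]) (rule *)
      moreover have "\<not> (\<forall>k\<in>servers. ok y (?\<rho> k))" using i u by auto
      moreover have "inst y ?\<rho> \<in> I" by (rule I[OF y]) (rule *)
      ultimately show ?thesis
        unfolding good_def inst_update[OF i] by (intro prob_accepts_infeasible[OF solves]) simp_all
    qed
    have "(\<Sum>u\<in>U. w_minus y u * ?p u) \<le> (\<Sum>u\<in>U. w_minus y u * (1 / 3) + (if ok y u then w_minus y u else 0))"
    proof (rule sum_mono)
      fix u assume u: "u \<in> U"
      show "w_minus y u * ?p u \<le> w_minus y u * (1 / 3) + (if ok y u then w_minus y u else 0)"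
      proof (cases "ok y u")
        case True
        have "w_minus y u * ?p u \<le> w_minus y u * 1" by (intro mult_left_mono w_minus_nonneg) simp
        then show ?thesis using True w_minus_nonneg[of y u] by simp
      next
        case False
        then show ?thesis using mult_left_mono[OF p[OF u False] w_minus_nonneg[of y u]] by simp
      qed
    qed
    also have "\<dots> = (\<Sum>u\<in>U. w_minus y u) * (1 / 3) + (\<Sum>u | u \<in> U \<and> ok y u. w_minus y u)"
      using fin by (simp add: sum.distrib sum.inter_filter sum_divide_distrib)
    also have "\<dots> \<le> 1 / 3 + \<epsilon>" using w_minus_sum[OF y] w_minus_good[OF y] by simp
    finally show "(\<Sum>u\<in>U. w_minus y u * ?p u) \<le> 1 / 3 + \<epsilon>" .
  qed
  also have "\<dots> = measure_pmf.expectation R advantage"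
    unfolding advantage_def
    by (simp add: Bochner_Integration.integral_sum Bochner_Integration.integral_diff Bochner_Integration.integrable_sum Bochner_Integration.integrable_diff expectation_of_bool)
  finally show False using upper by simp
qed

end

lemma comm_at_least_mono: "comm_at_least B I R \<Longrightarrow> B' \<le> B \<Longrightarrow> comm_at_least B' I R"
  unfolding comm_at_least_def by (meson order_trans)

lemma execution_link_less: "execution P X T \<Longrightarrow> e \<in> set T \<Longrightarrow> fst e < length X"
  by (induction rule: execution.induct) auto

lemma num_messages_pos:
  assumes "(i, b) \<in> set T"
  shows "num_messages P i T > 0"
proof -
  have "link_view i T \<noteq> []"
    using assms by (force simp: link_view_def filter_empty_conv)
  then show ?thesis by (simp add: num_messages_def Let_def)
qed

lemma dim_row_append_rows [simp]: "dim_row (A @\<^sub>r B) = dim_row A + dim_row B"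
  by (simp add: append_rows_def)

lemma dim_row_stack_mat: "dim_row (stack_mat d X) = (\<Sum>p\<leftarrow>X. dim_row (fst p))"
  by (induction X) auto

lemma L_bit_of_int: "\<bar>k\<bar> < 2 ^ (L - 1) \<Longrightarrow> real_of_int k \<in> L_bit L"
  unfolding L_bit_def by (rule imageI) (auto simp: abs_less_iff)

section \<open>Bounded precision\<close>

definition const_input :: "nat \<Rightarrow> real \<Rightarrow> server_input" where
  "const_input d c = (0\<^sub>m 1 d, vec 1 (\<lambda>_. c))"

lemma const_instance:
  assumes "d \<ge> 2" "L \<ge> 2" and f: "\<And>i. i < s \<Longrightarrow> f i = 0 \<or> f i = -1"
  shows "map (\<lambda>i. const_input d (f i)) [0..<s] \<in> LF_promise (2 * (s + d)) s d L"
    and "feasible d (map (\<lambda>i. const_input d (f i)) [0..<s]) \<longleftrightarrow> (\<forall>i<s. f i = 0)"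
proof -
  let ?X = "map (\<lambda>i. const_input d (f i)) [0..<s]"
  have "(1::int) < 2 ^ (L - 1)" using assms by (intro one_less_power) auto
  then have L: "0 \<in> L_bit L" "-1 \<in> L_bit L"
    using L_bit_of_int[of 0 L] L_bit_of_int[of "-1" L] by simp_all
  have "f i \<in> L_bit L" if "i < s" for i using f[OF that] L by auto
  then have I: "?X \<in> LF_instances s d L"
    using L(1) by (auto simp: LF_instances_def const_input_def elements_mat_def vec_set_def)
  have "(\<Sum>p\<leftarrow>?X. dim_row (fst p)) = s" by (simp add: const_input_def comp_def sum_list_triv)
  then show "?X \<in> LF_promise (2 * (s + d)) s d L"
    using I by (simp add: LF_promise_def dim_row_stack_mat)
  have eq: "0\<^sub>m 1 d *\<^sub>v x \<le> vec 1 (\<lambda>_. c) \<longleftrightarrow> 0 \<le> c" if "x \<in> carrier_vec d" for x :: "real vec" and c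
    using that by (auto simp: less_eq_vec_def)
  have "feasible d ?X \<longleftrightarrow> (\<exists>x \<in> (carrier_vec d :: real vec set). \<forall>i<s. 0 \<le> f i)"
    unfolding feasible_iff[OF I] by (rule bex_cong[OF refl]) (auto simp: const_input_def eq[unfolded One_nat_def])
  also have "\<dots> \<longleftrightarrow> (\<forall>i<s. f i = 0)"
  proof -
    have "0 \<le> f i \<longleftrightarrow> f i = 0" if "i < s" for i using f[OF that] by auto
    then show ?thesis by (auto intro: exI[of _ "0\<^sub>v d"])
  qed
  finally show "feasible d ?X \<longleftrightarrow> (\<forall>i<s. f i = 0)" .
qed

text \<open>If link \<open>i\<close> stays empty on the all-zero instance, making the constraint of
  server \<open>i\<close> contradictory does not change the run. So the acceptance gap at
  \<open>i\<close> is at most the length of link \<open>i\<close>; the gaps have expectation at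
  least \<open>1/3\<close> each, and the lengths add up to the transcript.\<close>

lemma comm_ge_third:
  assumes "d \<ge> 2" "L \<ge> 2" "s \<ge> 2" and sub: "LF_promise (2 * (s + d)) s d L \<subseteq> I" and solves: "solves_LF d I R"
  shows "comm_at_least (real s / 3) I R"
proof (rule ccontr)
  assume no: "\<not> comm_at_least (real s / 3) I R"
  define X where "X f = map (\<lambda>i. const_input d (f i)) [0..<s]" for f
  define bad :: "nat \<Rightarrow> nat \<Rightarrow> real" where "bad i j = (if j = i then -1 else 0)" for i j
  let ?X0 = "X (\<lambda>_. 0)"
  have X0: "?X0 \<in> I" "feasible d ?X0"
    using const_instance[of d L s "\<lambda>_. 0"] assms(1,2) sub by (auto simp: X_def)
  have Xi: "X (bad i) \<in> I" "\<not> feasible d (X (bad i))" if "i < s" for i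
    using const_instance[of d L s "bad i"] assms(1,2) sub that by (auto simp: X_def bad_def)
  have upd: "X (bad i) = ?X0[i := const_input d (-1)]" if "i < s" for i
    using that by (intro nth_equalityI) (auto simp: X_def bad_def nth_list_update)
  define B where "B = real_of_int (\<lceil>real s / 3\<rceil> - 1)"
  have B: "B < real s / 3" unfolding B_def by linarith
  have pt: "(\<Sum>i<s. of_bool (accepts P ?X0) - of_bool (accepts P (X (bad i)))) \<le> B" if P: "P \<in> set_pmf R" for P
  proof -
    obtain T where T: "complete_execution P ?X0 T" using solves P X0 by (auto simp: solves_LF_def)
    then have "\<not> real s / 3 \<le> real (length T)" using no P X0 unfolding comm_at_least_def by blast
    then have "int (length T) < \<lceil>real s / 3\<rceil>" by (simp add: less_ceiling_iff)
    then have len: "real (length T) \<le> B" unfolding B_def by linarith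
    have "of_bool (accepts P ?X0) - of_bool (accepts P (X (bad i))) \<le> real (length (link_view i T))" if i: "i < s" for i
    proof (cases "accepts P ?X0 \<and> link_view i T = []")
      case True
      then have "answer P T" using T complete_execution_unique unfolding accepts_def by metis
      moreover have "complete_execution P (X (bad i)) T"
        unfolding upd[OF i] using T True by (intro complete_execution_replace) auto
      ultimately have "accepts P (X (bad i))" by (auto simp: accepts_def)
      then show ?thesis by simp
    next
      case False
      show ?thesis
      proof (cases "accepts P ?X0")
        case True
        then have "1 \<le> length (link_view i T)" using False by (cases "link_view i T") auto
        then have "1 \<le> real (length (link_view i T))" by linarith
        then show ?thesis using True by (simp add: of_bool_def)
      qed (simp add: of_bool_def)
    qed
    then have "(\<Sum>i<s. of_bool (accepts P ?X0) - of_bool (accepts P (X (bad i)))) \<le> (\<Sum>i<s. real (length (link_view i T)))"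
      by (intro sum_mono) auto
    also have "\<dots> \<le> real (length T)"
      using sum_link_views_le[of "{..<s}" T] by (simp flip: of_nat_sum)
    finally show ?thesis using len by simp
  qed
  have "real s / 3 = (\<Sum>i<s. 2 / 3 - 1 / 3)" by simp
  also have "\<dots> \<le> (\<Sum>i<s. measure_pmf.prob R {P. accepts P ?X0} - measure_pmf.prob R {P. accepts P (X (bad i))})"
    using prob_accepts_feasible[OF solves X0] prob_accepts_infeasible[OF solves Xi]
    by (intro sum_mono diff_mono) auto
  also have "\<dots> = measure_pmf.expectation R (\<lambda>P. \<Sum>i<s. of_bool (accepts P ?X0) - of_bool (accepts P (X (bad i))))"
    by (simp add: Bochner_Integration.integral_sum Bochner_Integration.integral_diff Bochner_Integration.integrable_diff expectation_of_bool del: sum_subtractf)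
  also have "\<dots> \<le> B"
  proof (rule measure_pmf.integral_le_const)
    show "AE P in measure_pmf R. (\<Sum>i<s. of_bool (accepts P ?X0) - of_bool (accepts P (X (bad i)))) \<le> B"
      by (rule AE_pmfI) (rule pt)
  qed (intro Bochner_Integration.integrable_sum Bochner_Integration.integrable_diff integrable_of_bool)
  finally show False using B by simp
qed

section \<open>Encoding as linear feasibility\<close>

lemma digits_exist:
  assumes "0 \<le> B" "\<bar>z\<bar> \<le> (int q + 1) * B"
  shows "\<exists>\<zeta>. (\<forall>j. \<bar>\<zeta> j\<bar> \<le> B) \<and> (\<Sum>j\<le>q. \<zeta> j) = z"
  using assms(2)
proof (induction q arbitrary: z)
  case 0
  then show ?case by (intro exI[of _ "\<lambda>_. z"]) auto
next
  case (Suc q)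
  \<comment> \<open>Greedy choice: clamping \<open>z\<close> leaves a remainder within reach of the
    other digits.\<close>
  define c where "c = max (- B) (min B z)"
  have "\<bar>z - c\<bar> \<le> (int q + 1) * B"
    using Suc.prems assms(1) by (auto simp: c_def algebra_simps max_def min_def abs_if split: if_splits)
  then obtain \<zeta> where \<zeta>: "\<forall>j. \<bar>\<zeta> j\<bar> \<le> B" "(\<Sum>j\<le>q. \<zeta> j) = z - c" using Suc.IH by blast
  have "\<bar>c\<bar> \<le> B" using assms(1) by (auto simp: c_def)
  moreover have "(\<Sum>j\<le>Suc q. (\<zeta>(Suc q := c)) j) = (\<Sum>j\<le>q. \<zeta> j) + c"
    by (auto intro!: sum.cong)
  ultimately show ?case using \<zeta> by (intro exI[of _ "\<zeta>(Suc q := c)"]) auto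
qed

definition digit :: "nat \<Rightarrow> int \<Rightarrow> int \<Rightarrow> nat \<Rightarrow> int" where
  "digit q B z = (SOME \<zeta>. (\<forall>j. \<bar>\<zeta> j\<bar> \<le> B) \<and> (\<Sum>j\<le>q. \<zeta> j) = z)"

lemma digit:
  assumes "0 \<le> B" "\<bar>z\<bar> \<le> (int q + 1) * B"
  shows "\<bar>digit q B z j\<bar> \<le> B" "(\<Sum>j\<le>q. digit q B z j) = z"
  using someI_ex[OF digits_exist[OF assms]] by (auto simp: digit_def)

text \<open>
  A right-hand side may exceed \<open>L\<close> bits, so it is spread over the coefficients of the last
  \<open>d - n\<close> coordinates, which the first server fixes to \<open>1\<close>.
\<close>

definition point :: "nat \<Rightarrow> (nat \<Rightarrow> int) \<Rightarrow> nat \<Rightarrow> int" where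
  "point n y j = (if j < n then y j else 1)"

definition enc_point :: "nat \<Rightarrow> nat \<Rightarrow> (nat \<Rightarrow> int) \<Rightarrow> server_input" where
  "enc_point d n y =
    (mat (2 * d) d (\<lambda>(i, j). real_of_int (if i = j then 1 else if i = d + j then -1 else 0)),
     vec (2 * d) (\<lambda>i. real_of_int (if i < d then point n y i else - point n y (i - d))))"

definition enc_halfspace :: "nat \<Rightarrow> nat \<Rightarrow> int \<Rightarrow> (nat \<Rightarrow> int) \<times> int \<Rightarrow> server_input" where
  "enc_halfspace d n B = (\<lambda>(x, z).
    (mat 1 d (\<lambda>(_, j). real_of_int (if j < n then - x j else digit (d - n) B z (j - n))),
     vec 1 (\<lambda>_. real_of_int (- digit (d - n) B z (d - n)))))"

lemma enc_point_sat:
  assumes x: "x \<in> carrier_vec d"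
  shows "(\<lambda>(A, b). A *\<^sub>v x \<le> b) (enc_point d n y) \<longleftrightarrow> (\<forall>i<d. x $ i = real_of_int (point n y i))"
proof -
  let ?A = "fst (enc_point d n y)" and ?b = "snd (enc_point d n y)"
  have row: "(?A *\<^sub>v x) $ i = x $ i" "(?A *\<^sub>v x) $ (d + i) = - x $ i" if i: "i < d" for i
  proof -
    have r: "(?A *\<^sub>v x) $ k = (\<Sum>j = 0..<d. real_of_int (if k = j then 1 else if k = d + j then -1 else 0) * x $ j)"
      if "k < 2 * d" for k
      using that x by (simp add: enc_point_def scalar_prod_def)
    have i2: "i < 2 * d" "d + i < 2 * d" using i by auto
    have "(?A *\<^sub>v x) $ i = (\<Sum>j = 0..<d. (if j = i then x $ j else 0))"
      using i unfolding r[OF i2(1)] by (intro sum.cong) auto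
    then show "(?A *\<^sub>v x) $ i = x $ i" using i by simp
    have "(?A *\<^sub>v x) $ (d + i) = (\<Sum>j = 0..<d. (if j = i then - x $ j else 0))"
      unfolding r[OF i2(2)] by (rule sum.cong) auto
    then show "(?A *\<^sub>v x) $ (d + i) = - x $ i" using i by simp
  qed
  have "?A *\<^sub>v x \<le> ?b \<longleftrightarrow> (\<forall>i<2*d. (?A *\<^sub>v x) $ i \<le> ?b $ i)"
    by (simp add: less_eq_vec_def enc_point_def)
  also have "\<dots> \<longleftrightarrow> (\<forall>i<d. (?A *\<^sub>v x) $ i \<le> ?b $ i \<and> (?A *\<^sub>v x) $ (d + i) \<le> ?b $ (d + i))"
  proof (intro iffI allI impI)
    fix i assume *: "\<forall>i<d. (?A *\<^sub>v x) $ i \<le> ?b $ i \<and> (?A *\<^sub>v x) $ (d + i) \<le> ?b $ (d + i)" "i < 2 * d"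
    show "(?A *\<^sub>v x) $ i \<le> ?b $ i"
    proof (cases "i < d")
      case False
      then have "i - d < d" "i = d + (i - d)" using *(2) by auto
      then show ?thesis using *(1) by metis
    qed (use * in blast)
  qed auto
  also have "\<dots> \<longleftrightarrow> (\<forall>i<d. x $ i = real_of_int (point n y i))"
    using row by (force simp: enc_point_def)
  finally show ?thesis by (simp add: case_prod_beta)
qed

lemma enc_halfspace_sat:
  assumes x: "x \<in> carrier_vec d" "\<forall>i<d. x $ i = real_of_int (point n y i)"
    and n: "n \<le> d" and B: "0 \<le> B" "\<bar>z\<bar> \<le> (int (d - n) + 1) * B"
  shows "(\<lambda>(A, b). A *\<^sub>v x \<le> b) (enc_halfspace d n B (a, z)) \<longleftrightarrow> z \<le> (\<Sum>j<n. a j * y j)"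
proof -
  let ?A = "fst (enc_halfspace d n B (a, z))" and ?b = "snd (enc_halfspace d n B (a, z))"
  let ?D = "digit (d - n) B z"
  have "(?A *\<^sub>v x) $ 0 = real_of_int (\<Sum>j = 0..<d. (if j < n then - a j else ?D (j - n)) * point n y j)"
    using x unfolding of_int_sum of_int_mult by (auto simp: enc_halfspace_def scalar_prod_def intro!: sum.cong)
  also have "(\<Sum>j = 0..<d. (if j < n then - a j else ?D (j - n)) * point n y j) =
     (\<Sum>j = 0..<n. - (a j * y j)) + (\<Sum>j = n..<d. ?D (j - n))"
    using n by (subst sum.atLeastLessThan_concat[of 0 n d, symmetric]) (auto simp: point_def intro!: arg_cong2[of _ _ _ _ "(+)"] sum.cong)
  also have "(\<Sum>j = n..<d. ?D (j - n)) = (\<Sum>j<d - n. ?D j)"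
    by (rule sum.reindex_bij_witness[of _ "\<lambda>j. j + n" "\<lambda>j. j - n"]) auto
  also have "\<dots> = z - ?D (d - n)"
    using digit(2)[OF B] by (simp flip: lessThan_Suc_atMost)
  finally have eq: "(?A *\<^sub>v x) $ 0 = real_of_int (z - ?D (d - n) - (\<Sum>j<n. a j * y j))"
    by (simp add: sum_negf atLeast0LessThan)
  have "?A *\<^sub>v x \<le> ?b \<longleftrightarrow> (?A *\<^sub>v x) $ 0 \<le> ?b $ 0"
    by (simp add: less_eq_vec_def enc_halfspace_def)
  also have "\<dots> \<longleftrightarrow> z \<le> (\<Sum>j<n. a j * y j)"
  proof -
    have "?b $ 0 = real_of_int (- ?D (d - n))" by (simp add: enc_halfspace_def)
    then show ?thesis unfolding eq by (simp only: of_int_le_iff) linarith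
  qed
  finally show ?thesis by (simp add: case_prod_beta)
qed

text \<open>The first server leaves \<open>point n y\<close> as the only candidate, so feasibility
  becomes one scalar test per remaining server. Its \<open>2 * d\<close> inequalities and one per
  other server stay within the promised number of rows.\<close>

lemma enc_instance:
  fixes f :: "nat \<Rightarrow> (nat \<Rightarrow> int) \<times> int"
  assumes n: "n \<le> d" and L: "L \<ge> 2" and s: "s \<ge> 2" and B: "B = 2 ^ (L - 1) - 1"
    and y: "\<And>j. j < n \<Longrightarrow> \<bar>y j\<bar> \<le> B"
    and f: "\<And>k j. k \<in> {1..<s} \<Longrightarrow> j < n \<Longrightarrow> \<bar>fst (f k) j\<bar> \<le> B"
      "\<And>k. k \<in> {1..<s} \<Longrightarrow> \<bar>snd (f k)\<bar> \<le> (int (d - n) + 1) * B"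
  shows "enc_point d n y # map (\<lambda>k. enc_halfspace d n B (f k)) [1..<s] \<in> LF_promise (2 * (s + d)) s d L" (is "?X \<in> _")
    and "feasible d (enc_point d n y # map (\<lambda>k. enc_halfspace d n B (f k)) [1..<s]) \<longleftrightarrow>
      (\<forall>k\<in>{1..<s}. snd (f k) \<le> (\<Sum>j<n. fst (f k) j * y j))"
proof -
  have "(2::int) ^ 1 \<le> 2 ^ (L - 1)" using L by (intro power_increasing) auto
  then have B1: "1 \<le> B" using B by simp
  have bit: "real_of_int k \<in> L_bit L" if "\<bar>k\<bar> \<le> B" for k using that B by (intro L_bit_of_int) simp
  have bit': "- real_of_int k \<in> L_bit L" if "\<bar>k\<bar> \<le> B" for k using bit[of "- k"] that by simp
  have pt: "\<bar>point n y j\<bar> \<le> B" for j using y B1 by (simp add: point_def)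
  have X0: "(\<lambda>(A, b). A \<in> carrier_mat (dim_vec b) d \<and> elements_mat A \<subseteq> L_bit L \<and> set\<^sub>v b \<subseteq> L_bit L) (enc_point d n y)"
    using B1 pt by (auto simp: enc_point_def elements_mat_def vec_set_def intro!: bit bit')
  have Xk: "(\<lambda>(A, b). A \<in> carrier_mat (dim_vec b) d \<and> elements_mat A \<subseteq> L_bit L \<and> set\<^sub>v b \<subseteq> L_bit L) (enc_halfspace d n B (f k))"
    if k: "k \<in> {1..<s}" for k
  proof -
    have "\<bar>digit (d - n) B (snd (f k)) j\<bar> \<le> B" for j using digit(1)[OF _ f(2)[OF k]] B1 by simp
    then show ?thesis using f(1)[OF k]
      by (auto simp: enc_halfspace_def case_prod_beta elements_mat_def vec_set_def intro!: bit bit')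
  qed
  have I: "?X \<in> LF_instances s d L"
    using X0 Xk s by (auto simp: LF_instances_def)
  have "(\<Sum>p\<leftarrow>?X. dim_row (fst p)) = 2 * d + (s - 1)"
    by (simp add: enc_point_def enc_halfspace_def case_prod_beta comp_def sum_list_triv)
  then show "?X \<in> LF_promise (2 * (s + d)) s d L"
    using I by (simp add: LF_promise_def dim_row_stack_mat)
  let ?ok = "\<forall>k\<in>{1..<s}. snd (f k) \<le> (\<Sum>j<n. fst (f k) j * y j)"
  let ?sat = "\<lambda>x (A, b). A *\<^sub>v x \<le> b"
  have sat: "(\<forall>p\<in>set ?X. ?sat x p) \<longleftrightarrow> (\<forall>i<d. x $ i = real_of_int (point n y i)) \<and> ?ok" if x: "x \<in> carrier_vec d" for x
  proof -
    have h: "?sat x (enc_halfspace d n B (f k)) \<longleftrightarrow> snd (f k) \<le> (\<Sum>j<n. fst (f k) j * y j)"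
      if "k \<in> {1..<s}" "\<forall>i<d. x $ i = real_of_int (point n y i)" for k
      using enc_halfspace_sat[OF x that(2) n _ f(2)[OF that(1)], of "fst (f k)"] B1 by simp
    have "(\<forall>p\<in>set ?X. ?sat x p) \<longleftrightarrow>
        ?sat x (enc_point d n y) \<and> (\<forall>k\<in>{1..<s}. ?sat x (enc_halfspace d n B (f k)))" by simp
    then show ?thesis
      unfolding enc_point_sat[OF x] by (simp only:) (intro conj_cong ball_cong refl h)
  qed
  have "feasible d ?X \<longleftrightarrow> (\<exists>x\<in>carrier_vec d. (\<forall>i<d. x $ i = real_of_int (point n y i)) \<and> ?ok)"
    unfolding feasible_iff[OF I] using sat by blast
  also have "\<dots> \<longleftrightarrow> ?ok"
    by (auto intro!: bexI[of _ "vec d (\<lambda>i. real_of_int (point n y i))"])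
  finally show "feasible d ?X \<longleftrightarrow> ?ok" .
qed

section \<open>The hard distribution as an instance of the direct sum\<close>

context lf_params begin

text \<open>With \<open>c = T\<close> the threshold is centred at distance \<open>T\<close> below
  the inner product, so the constraint is mostly satisfied; \<open>c = - T\<close> centres it
  above.\<close>

definition wt :: "int \<Rightarrow> (nat \<Rightarrow> int) \<Rightarrow> (nat \<Rightarrow> int) \<times> int \<Rightarrow> real" where
  "wt c y p = fejer M mb (ip (fst p) y - snd p - c) / real N ^ n"

lemma wt_nonneg: "0 \<le> wt c y p"
  by (simp add: wt_def)

lemma sum_wt: "(\<Sum>p\<in>vecs \<times> zs. wt c y p) = 1"
proof -
  have "(\<Sum>p\<in>vecs \<times> zs. wt c y p) = (\<Sum>x\<in>vecs. (\<Sum>z\<in>zs. fejer M mb ((ip x y - c) - z)) / real N ^ n)"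
    by (simp add: sum.cartesian_product' wt_def sum_divide_distrib algebra_simps)
  also have "\<dots> = 1"
    using params_pos widths_le by (subst sum_fejer_zs) (auto simp: card_vecs)
  finally show ?thesis .
qed

lemma sum_wt_filter_le:
  assumes "\<And>x. x \<in> vecs \<Longrightarrow> (\<Sum>z | z \<in> zs \<and> S x z. fejer M mb (ip x y - z - c)) \<le> 25 / real r"
  shows "(\<Sum>p | p \<in> vecs \<times> zs \<and> S (fst p) (snd p). wt c y p) \<le> 25 / real r"
proof -
  have "(\<Sum>p | p \<in> vecs \<times> zs \<and> S (fst p) (snd p). wt c y p) =
     (\<Sum>x\<in>vecs. (\<Sum>z | z \<in> zs \<and> S x z. fejer M mb (ip x y - z - c)) / real N ^ n)"
  proof -
    have "{p \<in> vecs \<times> zs. S (fst p) (snd p)} = Sigma vecs (\<lambda>x. {z \<in> zs. S x z})" by auto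
    then show ?thesis
      by (simp only: sum_divide_distrib wt_def) (subst sum.Sigma, auto simp: case_prod_beta)
  qed
  also have "\<dots> \<le> (\<Sum>x\<in>vecs. (25 / real r) / real N ^ n)"
    using assms by (intro sum_mono divide_right_mono) auto
  also have "\<dots> = 25 / real r" using params_pos by (simp add: card_vecs)
  finally show ?thesis .
qed

lemma direct_sum_lf:
  assumes l: "2 ^ (l + 1) * \<delta> \<le> 1 / 20"
  shows "direct_sum l vecs (vecs \<times> zs) (wt T) (wt (- T)) (\<lambda>y p. snd p \<le> ip (fst p) y) (\<lambda>j\<in>{..<n}. 0, 0)
    (1 / 8 + 1 / 20 + 100 / real r) (25 / real r)"
proof
  have v0: "(\<lambda>j\<in>{..<n}. 0) \<in> vecs" using params_pos by (auto simp: vecs_def)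
  then show "vecs \<noteq> {}" by auto
  show "(\<lambda>j\<in>{..<n}. 0, 0) \<in> vecs \<times> zs" using v0 params_pos n_ge by (auto simp: zs_def M_def)
  \<comment> \<open>The replacement for violated constraints is \<open>0 \<ge> 0\<close>, which
    every point satisfies.\<close>
  show "snd (\<lambda>j\<in>{..<n}. 0 :: int, 0) \<le> ip (fst (\<lambda>j\<in>{..<n}. 0, 0 :: int)) y" for y
    by (simp add: ip_def)
  show "finite vecs" "finite (vecs \<times> zs)" by auto
  show "0 \<le> wt T y p" "0 \<le> wt (- T) y p" for y p by (rule wt_nonneg)+
  show "(\<Sum>p\<in>vecs \<times> zs. wt T y p) = 1" "(\<Sum>p\<in>vecs \<times> zs. wt (- T) y p) = 1" for y by (rule sum_wt)+
  show "(\<Sum>p | p \<in> vecs \<times> zs \<and> \<not> snd p \<le> ip (fst p) y. wt T y p) \<le> 25 / real r" if "y \<in> vecs" for y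
    using wrong_label_plus[OF _ that] by (intro sum_wt_filter_le[where S = "\<lambda>x z. \<not> z \<le> ip x y"]) (simp add: not_le)
  show "(\<Sum>p | p \<in> vecs \<times> zs \<and> snd p \<le> ip (fst p) y. wt (- T) y p) \<le> 25 / real r" if "y \<in> vecs" for y
    using wrong_label_minus[OF _ that] by (intro sum_wt_filter_le[where S = "\<lambda>x z. z \<le> ip x y"]) simp
  fix \<alpha> :: "bool list \<Rightarrow> (nat \<Rightarrow> int) \<times> int \<Rightarrow> real" and \<beta> :: "bool list \<Rightarrow> (nat \<Rightarrow> int) \<Rightarrow> real"
  let ?V = "{v :: bool list. length v \<le> l}"
  assume \<alpha>: "\<And>v p. 0 \<le> \<alpha> v p \<and> \<alpha> v p \<le> 1" and \<beta>: "\<And>v y. y \<in> vecs \<Longrightarrow> 0 \<le> \<beta> v y \<and> \<beta> v y \<le> 1"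
    and \<Phi>: "\<And>p y. p \<in> vecs \<times> zs \<Longrightarrow> y \<in> vecs \<Longrightarrow> (\<Sum>v\<in>?V. \<alpha> v p * \<beta> v y) \<le> 1"
  let ?s = "\<lambda>x z y. (fejer M mb (ip x y - z - T) - fejer M mb (ip x y - z + T)) * (\<Sum>v\<in>?V. \<alpha> v (x, z) * \<beta> v y)"
  have "(\<Sum>y\<in>vecs. \<Sum>p\<in>vecs \<times> zs. (wt T y p - wt (- T) y p) * (\<Sum>v\<in>?V. \<alpha> v p * \<beta> v y))
    = (\<Sum>y\<in>vecs. \<Sum>p\<in>vecs \<times> zs. ?s (fst p) (snd p) y / real N ^ n)"
    by (simp add: wt_def flip: diff_divide_distrib)
  also have "\<dots> = (\<Sum>p\<in>vecs \<times> zs. \<Sum>y\<in>vecs. ?s (fst p) (snd p) y / real N ^ n)"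
    by (rule sum.swap)
  also have "\<dots> = (\<Sum>x\<in>vecs. \<Sum>z\<in>zs. \<Sum>y\<in>vecs. ?s x z y) / real N ^ n"
    by (simp add: sum.cartesian_product' sum_divide_distrib)
  also have "\<dots> \<le> (real N ^ (2 * n) * (1 / 8 + real (card ?V) * \<delta> + 100 / real r)) / real N ^ n"
    using \<alpha> \<beta> \<Phi> finite_bool_lists[of l]
    by (intro divide_right_mono rectangles_cannot_distinguish) auto
  also have "\<dots> = real N ^ n * (1 / 8 + real (card ?V) * \<delta> + 100 / real r)"
    using params_pos by (simp add: mult_2 power_add)
  also have "\<dots> \<le> real N ^ n * (1 / 8 + 1 / 20 + 100 / real r)"
  proof (intro mult_left_mono add_mono order_refl)
    have "real (card ?V) \<le> real (2 ^ (l + 1))" using card_bool_lists[of l] by (simp only: of_nat_le_iff)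
    then have "real (card ?V) * \<delta> \<le> 2 ^ (l + 1) * \<delta>" by (intro mult_right_mono) (auto simp: \<delta>_def)
    then show "real (card ?V) * \<delta> \<le> 1 / 20" using l by linarith
  qed simp
  finally show "(\<Sum>y\<in>vecs. \<Sum>p\<in>vecs \<times> zs. (wt T y p - wt (- T) y p) * (\<Sum>v\<in>?V. \<alpha> v p * \<beta> v y))
    \<le> real (card vecs) * (1 / 8 + 1 / 20 + 100 / real r)"
    by (simp add: card_vecs)
qed

end

section \<open>The lower bound\<close>

lemma comm_lower_bound_large_L:
  assumes d: "d \<ge> 2" and L: "L \<ge> 2000" and s: "s \<ge> 2"
    and sub: "LF_promise (2 * (s + d)) s d L \<subseteq> I" and solves: "solves_LF d I R"
  shows "comm_at_least (real s * real d * real L / 8000) I R"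
proof -
  \<comment> \<open>Thresholds have size about \<open>n * 2 ^ (80 * h + 1)\<close>, and each digit
    has to fit into \<open>L - 1\<close> bits; \<open>120\<close> leaves ample room.\<close>
  define h where "h = L div 120"
  define r :: nat where "r = 16 ^ h"
  \<comment> \<open>Half of the coordinates carry the vectors. The others carry digits of the
    threshold, which grows with \<open>n\<close>; \<open>n \<le> 2 * (d - n + 1)\<close> provides
    enough of them for every \<open>d\<close>, and \<open>n \<ge> 2\<close> even for
    \<open>d = 2\<close>.\<close>
  define n where "n = d div 2 + 1"
  \<comment> \<open>There are at most \<open>2 ^ (n * h)\<close> link contents, while \<delta> is
    about \<open>4 ^ (- n * h)\<close> up to constants to the power \<open>n\<close>; since
    \<open>h \<ge> 16\<close>, the product is tiny.\<close>
  define l where "l = n * h - 1"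
  define B :: int where "B = 2 ^ (L - 1) - 1"
  have h: "16 \<le> h" "120 * h \<le> L" "L < 120 * h + 120" using L by (auto simp: h_def)
  have n: "2 \<le> n" "n \<le> d" "n \<le> 2 * (d - n + 1)" "d \<le> 2 * n" using d by (auto simp: n_def)
  have "n * h > 0" using n h by simp
  then have l: "l + 1 = n * h" by (simp add: l_def)
  have r: "1000 \<le> r" "real r \<ge> 10 ^ 6"
  proof -
    have "(16::nat) ^ 5 \<le> 16 ^ h" using h by (intro power_increasing) auto
    then have "1048576 \<le> r" by (simp add: r_def)
    then show "1000 \<le> r" "real r \<ge> 10 ^ 6" by auto
  qed
  interpret lf_params r n by unfold_locales (use r n in auto)
  have \<delta>: "2 ^ (l + 1) * \<delta> \<le> 1 / 20"
  proof -
    have "sqrt (1000 / real r) \<le> sqrt ((32 / 4 ^ h)\<^sup>2)"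
    proof (rule real_sqrt_le_mono)
      have "(4::real) ^ h * 4 ^ h = 16 ^ h" by (simp flip: power_mult_distrib)
      then have "(32 / 4 ^ h :: real)\<^sup>2 = 1024 / 16 ^ h"
        by (simp add: power_divide power2_eq_square)
      then show "1000 / real r \<le> (32 / 4 ^ h)\<^sup>2" by (simp add: r_def divide_right_mono)
    qed
    then have s: "sqrt (1000 / real r) \<le> 32 / 4 ^ h" by simp
    have "2 ^ h * sqrt (1000 / real r) \<le> 2 ^ h * (32 / 4 ^ h)" using s by (intro mult_left_mono) auto
    also have "\<dots> = 32 / 2 ^ h"
    proof -
      have "(4::real) ^ h = 2 ^ h * 2 ^ h" by (simp flip: power_mult_distrib)
      then show ?thesis by simp
    qed
    also have "\<dots> \<le> 32 / 2 ^ 16" using h by (intro divide_left_mono power_increasing) auto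
    finally have x: "2 ^ h * sqrt (1000 / real r) \<le> 1 / 2048" by simp
    have "2 ^ (l + 1) * \<delta> = 10 * (2 ^ h * sqrt (1000 / real r)) ^ n"
      unfolding l \<delta>_def by (simp only: power_mult_distrib power_mult mult.commute[of n] mult.left_commute)
    also have "\<dots> \<le> 10 * (1 / 2048) ^ n"
      using x by (intro mult_left_mono power_mono) auto
    also have "\<dots> \<le> 10 * (1 / 2048) ^ 2"
      using n by (intro mult_left_mono power_decreasing) auto
    finally show ?thesis by (simp add: power2_eq_square)
  qed
  interpret D: direct_sum s l vecs "vecs \<times> zs" "wt T" "wt (- T)" "\<lambda>y p. snd p \<le> ip (fst p) y" "(\<lambda>j\<in>{..<n}. 0, 0)"
    "enc_point d n" "enc_halfspace d n B" "1 / 8 + 1 / 20 + 100 / real r" "25 / real r"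
    by (rule direct_sum_lf[OF \<delta>])
  have vec_le: "\<bar>y j\<bar> \<le> B" if "y \<in> vecs" "j < n" for y j
  proof -
    have "0 \<le> y j" "y j < int N" using that by (auto simp: vecs_def PiE_iff)
    moreover have "int N = 2 ^ (40 * h)"
    proof -
      have "int N = (16 ^ h) ^ 10" unfolding N_def unfolding r_def by simp
      also have "(16::int) ^ h = 2 ^ (4 * h)" by (simp add: power_mult)
      also have "(2 ^ (4 * h)) ^ 10 = (2::int) ^ (40 * h)" by (simp flip: power_mult)
      finally show ?thesis .
    qed
    moreover have "(2::int) ^ (40 * h) \<le> 2 ^ (L - 1)" using h by (intro power_increasing) auto
    ultimately show ?thesis unfolding B_def by linarith
  qed
  have z_le: "\<bar>z\<bar> \<le> (int (d - n) + 1) * B" if "z \<in> zs" for z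
  proof -
    have "\<bar>z\<bar> \<le> int (2 * n * r ^ 20)" using that by (auto simp: zs_def M_def)
    also have "\<dots> = int n * (2 * 2 ^ (80 * h))"
    proof -
      have "(16::int) ^ h = 2 ^ (4 * h)" by (simp add: power_mult)
      then have "((16::int) ^ h) ^ 20 = 2 ^ (80 * h)" by (simp only:) (simp flip: power_mult)
      then show ?thesis by (simp add: r_def)
    qed
    also have "\<dots> \<le> int (2 * (d - n + 1)) * (2 * 2 ^ (80 * h))"
      using n by (intro mult_right_mono) auto
    also have "\<dots> = (int (d - n) + 1) * 2 ^ (80 * h + 2)" by (simp add: power_add)
    also have "\<dots> \<le> (int (d - n) + 1) * B"
    proof (intro mult_left_mono)
      have "(2::int) ^ (80 * h + 2) < 2 ^ (L - 1)" using h by (intro power_strict_increasing) auto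
      then show "(2::int) ^ (80 * h + 2) \<le> B" by (simp add: B_def)
    qed simp
    finally show ?thesis .
  qed
  have enc: "D.inst y \<rho> \<in> I" "feasible d (D.inst y \<rho>) \<longleftrightarrow> (\<forall>k\<in>D.servers. snd (\<rho> k) \<le> ip (fst (\<rho> k)) y)"
    if y: "y \<in> vecs" and \<rho>: "\<And>k. k \<in> D.servers \<Longrightarrow> \<rho> k \<in> vecs \<times> zs" for y \<rho>
  proof -
    have mem: "fst (\<rho> k) \<in> vecs" "snd (\<rho> k) \<in> zs" if "k \<in> {1..<s}" for k
      using \<rho>[of k] that by (auto simp: D.servers_def mem_Times_iff)
    have 1: "\<bar>fst (\<rho> k) j\<bar> \<le> B" if "k \<in> {1..<s}" "j < n" for k j
      using vec_le[OF mem(1)] that .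
    have 2: "\<bar>snd (\<rho> k)\<bar> \<le> (int (d - n) + 1) * B" if "k \<in> {1..<s}" for k
      using z_le[OF mem(2)] that .
    have "2 \<le> L" using L by simp
    note inst = enc_instance[OF n(2) this s B_def vec_le[OF y] 1 2]
    show "D.inst y \<rho> \<in> I"
      using inst(1) sub by (auto simp: D.inst_def)
    show "feasible d (D.inst y \<rho>) \<longleftrightarrow> (\<forall>k\<in>D.servers. snd (\<rho> k) \<le> ip (fst (\<rho> k)) y)"
      using inst(2) by (simp add: D.inst_def D.servers_def ip_def)
  qed
  have "comm_at_least ((real l + 1) * (real (s - 1) * (1 / 8))) I R"
  proof (rule D.comm_lower_bound[OF solves])
    have "100 / real r \<le> 1 / 10 ^ 4" "25 / real r \<le> 1 / 10 ^ 4" using r(2) by (simp_all add: divide_le_eq)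
    \<comment> \<open>The main terms give \<open>1/3 - 1/8 - 1/20 = 19/120\<close>, a little more
      than \<open>1/8\<close>.\<close>
    then have "1 / 8 \<le> 1 / 3 - (1 / 8 + 1 / 20 + 100 / real r) - 2 * (25 / real r)" by simp
    then show "(real l + 1) * (real (s - 1) * (1 / 8)) \<le> (real l + 1) * (real (s - 1) * (1 / 3 - (1 / 8 + 1 / 20 + 100 / real r) - 2 * (25 / real r)))"
      by (intro mult_left_mono) auto
  qed (use enc s in auto)
  \<comment> \<open>The losses \<open>n \<ge> d / 2\<close>, \<open>h \<ge> L / 240\<close>,
    \<open>s - 1 \<ge> s / 2\<close> and \<open>1 / 8\<close> multiply to
    \<open>1 / 7680\<close>.\<close>
  moreover have "real s * real d * real L / 8000 \<le> (real l + 1) * (real (s - 1) * (1 / 8))"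
  proof -
    have "real l + 1 = real (n * h)" using l by linarith
    then have "real l + 1 = real n * real h" by simp
    moreover have "real d / 2 \<le> real n" using n by linarith
    moreover have "real L / 240 \<le> real h" using h by linarith
    ultimately have "(real d / 2) * (real L / 240) \<le> real l + 1"
      by (simp only:) (intro mult_mono, auto)
    moreover have "real s / 2 * (1 / 8) \<le> real (s - 1) * (1 / 8)" using s by (simp add: of_nat_diff)
    ultimately have "((real d / 2) * (real L / 240)) * (real s / 2 * (1 / 8)) \<le> (real l + 1) * (real (s - 1) * (1 / 8))"
      by (intro mult_mono) auto
    moreover have "real s * real d * real L / 8000 \<le> ((real d / 2) * (real L / 240)) * (real s / 2 * (1 / 8))"
      by simp
    ultimately show ?thesis by linarith
  qed
  ultimately show ?thesis by (rule comm_at_least_mono)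
qed

lemma comm_positive_rounds:
  assumes "comm_at_least B I R" "B > 0" "rounds_at_most t I R"
  shows "t \<ge> 1"
proof -
  obtain X P T where X: "X \<in> I" "P \<in> set_pmf R" "complete_execution P X T" "B \<le> real (length T)"
    using assms(1) by (auto simp: comm_at_least_def)
  then have "T \<noteq> []" using assms(2) by auto
  then obtain i b where ib: "(i, b) \<in> set T" by (cases T) auto
  then have "i < length X"
    using X(3) execution_link_less[of P X T "(i, b)"] by (simp add: complete_execution_def)
  then have "real (num_messages P i T) \<le> t" using assms(3) X by (auto simp: rounds_at_most_def)
  moreover have "num_messages P i T > 0" using num_messages_pos[OF ib] .
  ultimately show ?thesis by linarith
qed

text \<open>The value \<open>1 / 8000\<close> serves for \<open>C\<close>, \<open>c\<close> and
  \<open>C'\<close>. For \<open>L < 2000\<close> it pushes the round bound below \<open>1\<close>,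
  which contradicts the positive communication from \<open>comm_ge_third\<close>; and with
  \<open>C'\<close> the claim is then at most \<open>s / 4\<close>, below
  \<open>s / 3\<close>.\<close>

theorem theorem1p16:
  shows "\<exists>C > 0. \<exists>c > 0. \<exists>K :: nat.
    (\<forall>s \<ge> 2. \<forall>d \<ge> 2. \<forall>L \<ge> 2. log 2 (real d) \<le> 5 * real L \<longrightarrow>
       (\<forall>I \<in> {LF_instances s d L, LF_promise (K * (s + d)) s d L}. \<forall>R.
          solves_LF d I R \<and> rounds_at_most (c * real L / log 2 (real L)) I R \<longrightarrow>
          comm_at_least (C * real s * real d * real L) I R)) \<and>
    (\<forall>d \<ge> 2. \<exists>C' > 0. \<forall>s \<ge> 2. \<forall>L \<ge> 2.
       (\<forall>I \<in> {LF_instances s d L, LF_promise (K * (s + d)) s d L}. \<forall>R.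
          solves_LF d I R \<longrightarrow>
          comm_at_least (C' * real s * real L) I R))"
proof (intro exI[of _ "1 / 8000 :: real"] exI[of _ "2 :: nat"] conjI allI impI ballI)
  fix s d L :: nat and I R
  assume *: "2 \<le> s" "2 \<le> d" "2 \<le> L" "I \<in> {LF_instances s d L, LF_promise (2 * (s + d)) s d L}"
    "solves_LF d I R \<and> rounds_at_most (1 / 8000 * real L / log 2 (real L)) I R"
  then have sub: "LF_promise (2 * (s + d)) s d L \<subseteq> I" by (auto simp: LF_promise_def)
  show "comm_at_least (1 / 8000 * real s * real d * real L) I R"
  proof (cases "2000 \<le> L")
    case True
    then show ?thesis using comm_lower_bound_large_L[OF _ _ _ sub] * by simp
  next
    case False
    have "1 \<le> 1 / 8000 * real L / log 2 (real L)"
      using comm_ge_third[OF _ _ _ sub] * by (intro comm_positive_rounds[of "real s / 3" I R]) auto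
    moreover have "log 2 2 \<le> log 2 (real L)" using * by (subst log_le_cancel_iff) auto
    then have "1 \<le> log 2 (real L)" by simp
    ultimately show ?thesis using False by (simp add: le_divide_eq)
  qed
next
  fix d s L :: nat and I R
  assume d: "2 \<le> d" and *: "2 \<le> s" "2 \<le> L"
    "I \<in> {LF_instances s d L, LF_promise (2 * (s + d)) s d L}" "solves_LF d I R"
  then have sub: "LF_promise (2 * (s + d)) s d L \<subseteq> I" by (auto simp: LF_promise_def)
  show "comm_at_least (1 / 8000 * real s * real L) I R"
  proof (cases "2000 \<le> L")
    case True
    have "comm_at_least (real s * real d * real L / 8000) I R"
      using comm_lower_bound_large_L[OF d True _ sub] * by simp
    moreover have "real s * 1 * real L \<le> real s * real d * real L"
      using d by (intro mult_right_mono mult_left_mono) auto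
    ultimately show ?thesis by (elim comm_at_least_mono) simp
  next
    case False
    then have "real s * real L \<le> real s * 2000" by (intro mult_left_mono) auto
    moreover have "comm_at_least (real s / 3) I R" using comm_ge_third[OF d _ _ sub] * by simp
    ultimately show ?thesis by (elim comm_at_least_mono) simp
  qed
qed simp_all

end
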